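(* Let $(M,J,g,G)$ be an almost anti-Hermitian manifold and let $\nabla$ be a torsion-free linear connection on $M$ such that $(\nabla,J)$ is a Codazzi pair. Then $(M,J,g,G)$ is an anti-Kähler manifold if and only if $$(\nabla_{JX}G)(Y,Z)=(\nabla_X g)(JY,JZ)$$ for all vector fields $X,Y,Z$ on $M$.
   Context: An almost anti-Hermitian manifold $(M,J,g,G)$ is a smooth $2n$-dimensional manifold $M$ with an almost complex structure $J$ ($J^{2}=-\mathrm{id}$), a pseudo-Riemannian metric $g$ of neutral signature $(n,n)$ satisfying $g(JX,JY)=-g(X,Y)$, equivalently $g(JX,Y)=g(X,JY)$, for all vector fields $X,Y$, and the twin metric $G(X,Y)=g(JX,Y)$. It is an anti-Kähler manifold if $\nabla^{g}J=0$, where $\nabla^{g}$ is the Levi-Civita connection of $g$. It is known that this is equivalent to $\Phi_J g=0$, where $\Phi_J$ is the Tachibana operator $(\Phi_J g)(X,Y,Z)=(L_{JX}g-L_X(g\circ J))(Y,Z)$, with $L$ the Lie derivative and $(g\circ J)(Y,Z)=g(JY,Z)$. $(\nabla,J)$ is a Codazzi pair if $(\nabla_Z J)X=(\nabla_X J)Z$ for all vector fields $X,Z$, where $(\nabla_Z J)X=\nabla_Z(JX)-J\nabla_Z X$. *)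

theory Defs
  imports "HOL-Analysis.Analysis" "HOL-Library.Function_Algebras"
begin

text \<open>
  Sums, differences and products of real-valued functions, tangent vectors and vector fields are the
  pointwise ones of \<^theory>\<open>HOL-Library.Function_Algebras\<close>.
\<close>

section \<open>Smooth manifolds\<close>

text \<open>Intended for open \<open>S\<close>: all iterated directional derivatives up to order \<open>k\<close> exist and are
  continuous on \<open>S\<close>.\<close>

primrec Ck_on ::
  "nat \<Rightarrow> 'e::euclidean_space set \<Rightarrow> ('e \<Rightarrow> 'f::real_normed_vector) \<Rightarrow> bool" where
  "Ck_on 0 S f \<longleftrightarrow> continuous_on S f"
| "Ck_on (Suc k) S f \<longleftrightarrow>
     (\<forall>x\<in>S. f differentiable (at x)) \<and> (\<forall>v. Ck_on k S (\<lambda>x. frechet_derivative f (at x) v))"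

definition smooth_on ::
  "'e::euclidean_space set \<Rightarrow> ('e \<Rightarrow> 'f::real_normed_vector) \<Rightarrow> bool" where
  "smooth_on S f \<longleftrightarrow> (\<forall>k. Ck_on k S f)"

type_synonym ('a, 'e) atlas = "('a set \<times> ('a \<Rightarrow> 'e)) set"

text \<open>The manifold is the whole type \<open>'a\<close>; the smooth structure is the one generated by the atlas,
  which need not be maximal. Its dimension is \<open>DIM('e)\<close>.\<close>

definition smooth_atlas ::
  "('a::{t2_space,second_countable_topology}, 'e::euclidean_space) atlas \<Rightarrow> bool" where
  "smooth_atlas A \<longleftrightarrow>
     (\<forall>(U, \<phi>)\<in>A. open U \<and> open (\<phi> ` U) \<and> (\<exists>\<psi>. homeomorphism U (\<phi> ` U) \<phi> \<psi>)) \<and>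
     (\<Union>(U, \<phi>)\<in>A. U) = UNIV \<and>
     (\<forall>(U, \<phi>)\<in>A. \<forall>(V, \<psi>)\<in>A. smooth_on (\<phi> ` (U \<inter> V)) (\<psi> \<circ> inv_into U \<phi>))"

definition smooth_fun ::
  "('a::{t2_space,second_countable_topology}, 'e::euclidean_space) atlas \<Rightarrow> ('a \<Rightarrow> real) \<Rightarrow> bool" where
  "smooth_fun A f \<longleftrightarrow> (\<forall>(U, \<phi>)\<in>A. smooth_on (\<phi> ` U) (f \<circ> inv_into U \<phi>))"

section \<open>Tangent vectors, vector fields and tensor fields\<close>

type_synonym 'a tangent = "('a \<Rightarrow> real) \<Rightarrow> real"
type_synonym 'a vfield = "'a \<Rightarrow> 'a tangent"
type_synonym 'a endo = "'a \<Rightarrow> 'a tangent \<Rightarrow> 'a tangent"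
type_synonym 'a bilin = "'a \<Rightarrow> 'a tangent \<Rightarrow> 'a tangent \<Rightarrow> real"
type_synonym 'a connection = "'a vfield \<Rightarrow> 'a vfield \<Rightarrow> 'a vfield"

text \<open>Derivations at \<open>p\<close> of the algebra of smooth functions; the value at a non-smooth function is
  fixed to be zero, so that derivations that agree on smooth functions are equal.\<close>

definition tangent_space ::
  "('a::{t2_space,second_countable_topology}, 'e::euclidean_space) atlas \<Rightarrow> 'a \<Rightarrow> 'a tangent set" where
  "tangent_space A p = {v.
     (\<forall>f. \<not> smooth_fun A f \<longrightarrow> v f = 0) \<and>
     (\<forall>f h. smooth_fun A f \<longrightarrow> smooth_fun A h \<longrightarrow> v (f + h) = v f + v h) \<and>
     (\<forall>c f. smooth_fun A f \<longrightarrow> v (\<lambda>q. c * f q) = c * v f) \<and>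
     (\<forall>f h. smooth_fun A f \<longrightarrow> smooth_fun A h \<longrightarrow> v (f * h) = v f * h p + f p * v h)}"

definition tscale :: "real \<Rightarrow> 'a tangent \<Rightarrow> 'a tangent" where
  "tscale c v = (\<lambda>f. c * v f)"

definition vector_fields ::
  "('a::{t2_space,second_countable_topology}, 'e::euclidean_space) atlas \<Rightarrow> 'a vfield set" where
  "vector_fields A = {X. (\<forall>p. X p \<in> tangent_space A p) \<and>
     (\<forall>f. smooth_fun A f \<longrightarrow> smooth_fun A (\<lambda>p. X p f))}"

definition fscale :: "('a \<Rightarrow> real) \<Rightarrow> 'a vfield \<Rightarrow> 'a vfield" where
  "fscale f X = (\<lambda>p. tscale (f p) (X p))"

definition vderiv :: "'a vfield \<Rightarrow> ('a \<Rightarrow> real) \<Rightarrow> 'a \<Rightarrow> real" where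
  "vderiv X f = (\<lambda>p. X p f)"

definition lie_bracket :: "'a vfield \<Rightarrow> 'a vfield \<Rightarrow> 'a vfield" where
  "lie_bracket X Y = (\<lambda>p f. X p (vderiv Y f) - Y p (vderiv X f))"

definition endo_app :: "'a endo \<Rightarrow> 'a vfield \<Rightarrow> 'a vfield" where
  "endo_app J X = (\<lambda>p. J p (X p))"

definition bilin_app :: "'a bilin \<Rightarrow> 'a vfield \<Rightarrow> 'a vfield \<Rightarrow> 'a \<Rightarrow> real" where
  "bilin_app g X Y = (\<lambda>p. g p (X p) (Y p))"

definition smooth_endo ::
  "('a::{t2_space,second_countable_topology}, 'e::euclidean_space) atlas \<Rightarrow> 'a endo \<Rightarrow> bool" where
  "smooth_endo A J \<longleftrightarrow>
     (\<forall>p. \<forall>u\<in>tangent_space A p. J p u \<in> tangent_space A p \<and>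
        (\<forall>v\<in>tangent_space A p. J p (u + v) = J p u + J p v) \<and>
        (\<forall>c. J p (tscale c u) = tscale c (J p u))) \<and>
     (\<forall>X\<in>vector_fields A. endo_app J X \<in> vector_fields A)"

definition smooth_sym_bilin ::
  "('a::{t2_space,second_countable_topology}, 'e::euclidean_space) atlas \<Rightarrow> 'a bilin \<Rightarrow> bool" where
  "smooth_sym_bilin A g \<longleftrightarrow>
     (\<forall>p. \<forall>u\<in>tangent_space A p. \<forall>v\<in>tangent_space A p. g p u v = g p v u \<and>
        (\<forall>w\<in>tangent_space A p. g p (u + v) w = g p u w + g p v w) \<and>
        (\<forall>c. g p (tscale c u) v = c * g p u v)) \<and>
     (\<forall>X\<in>vector_fields A. \<forall>Y\<in>vector_fields A. smooth_fun A (bilin_app g X Y))"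

text \<open>Signature \<open>(n,n)\<close>: every tangent space has a basis that is orthonormal with \<open>n\<close> vectors of
  square \<open>1\<close> and \<open>n\<close> of square \<open>-1\<close>. Linear independence is implied by the Gram matrix.\<close>

definition neutral_signature ::
  "nat \<Rightarrow> ('a::{t2_space,second_countable_topology}, 'e::euclidean_space) atlas \<Rightarrow> 'a bilin \<Rightarrow> bool" where
  "neutral_signature n A g \<longleftrightarrow> (\<forall>p. \<exists>e :: nat \<Rightarrow> 'a tangent.
     (\<forall>i<2*n. e i \<in> tangent_space A p) \<and>
     (\<forall>v\<in>tangent_space A p. \<exists>c. v = (\<Sum>i<2*n. tscale (c i) (e i))) \<and>
     (\<forall>i<2*n. \<forall>j<2*n. g p (e i) (e j) = (if i = j then if i < n then 1 else - 1 else 0)))"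

definition neutral_metric ::
  "nat \<Rightarrow> ('a::{t2_space,second_countable_topology}, 'e::euclidean_space) atlas \<Rightarrow> 'a bilin \<Rightarrow> bool" where
  "neutral_metric n A g \<longleftrightarrow> smooth_sym_bilin A g \<and> neutral_signature n A g"

section \<open>Connections\<close>

definition linear_connection ::
  "('a::{t2_space,second_countable_topology}, 'e::euclidean_space) atlas \<Rightarrow> 'a connection \<Rightarrow> bool" where
  "linear_connection A D \<longleftrightarrow>
     (\<forall>X\<in>vector_fields A. \<forall>Y\<in>vector_fields A. D X Y \<in> vector_fields A \<and>
        (\<forall>Z\<in>vector_fields A. D (X + Y) Z = D X Z + D Y Z \<and> D X (Y + Z) = D X Y + D X Z) \<and>
        (\<forall>f. smooth_fun A f \<longrightarrow> D (fscale f X) Y = fscale f (D X Y) \<and>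
           D X (fscale f Y) = fscale (vderiv X f) Y + fscale f (D X Y)))"

definition torsion_free ::
  "('a::{t2_space,second_countable_topology}, 'e::euclidean_space) atlas \<Rightarrow> 'a connection \<Rightarrow> bool" where
  "torsion_free A D \<longleftrightarrow>
     (\<forall>X\<in>vector_fields A. \<forall>Y\<in>vector_fields A. D X Y - D Y X = lie_bracket X Y)"

definition cov_bilin ::
  "'a connection \<Rightarrow> 'a vfield \<Rightarrow> 'a bilin \<Rightarrow> 'a vfield \<Rightarrow> 'a vfield \<Rightarrow> 'a \<Rightarrow> real" where
  "cov_bilin D X g Y Z =
     vderiv X (bilin_app g Y Z) - bilin_app g (D X Y) Z - bilin_app g Y (D X Z)"

definition cov_endo :: "'a connection \<Rightarrow> 'a vfield \<Rightarrow> 'a endo \<Rightarrow> 'a vfield \<Rightarrow> 'a vfield" where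
  "cov_endo D X J Y = D X (endo_app J Y) - endo_app J (D X Y)"

definition levi_civita ::
  "('a::{t2_space,second_countable_topology}, 'e::euclidean_space) atlas \<Rightarrow> 'a bilin \<Rightarrow>
     'a connection \<Rightarrow> bool" where
  "levi_civita A g D \<longleftrightarrow> linear_connection A D \<and> torsion_free A D \<and>
     (\<forall>X\<in>vector_fields A. \<forall>Y\<in>vector_fields A. \<forall>Z\<in>vector_fields A. cov_bilin D X g Y Z = 0)"

definition codazzi_pair ::
  "('a::{t2_space,second_countable_topology}, 'e::euclidean_space) atlas \<Rightarrow> 'a connection \<Rightarrow>
     'a endo \<Rightarrow> bool" where
  "codazzi_pair A D J \<longleftrightarrow>
     (\<forall>X\<in>vector_fields A. \<forall>Z\<in>vector_fields A. cov_endo D Z J X = cov_endo D X J Z)"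

section \<open>Anti-Hermitian and anti-Kaehler manifolds\<close>

definition almost_complex ::
  "('a::{t2_space,second_countable_topology}, 'e::euclidean_space) atlas \<Rightarrow> 'a endo \<Rightarrow> bool" where
  "almost_complex A J \<longleftrightarrow> smooth_endo A J \<and> (\<forall>p. \<forall>v\<in>tangent_space A p. J p (J p v) = - v)"

definition almost_anti_hermitian ::
  "nat \<Rightarrow> ('a::{t2_space,second_countable_topology}, 'e::euclidean_space) atlas \<Rightarrow> 'a endo \<Rightarrow>
     'a bilin \<Rightarrow> 'a bilin \<Rightarrow> bool" where
  "almost_anti_hermitian n A J g G \<longleftrightarrow>
     smooth_atlas A \<and> DIM('e) = 2 * n \<and> almost_complex A J \<and> neutral_metric n A g \<and>
     (\<forall>X\<in>vector_fields A. \<forall>Y\<in>vector_fields A.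
        bilin_app g (endo_app J X) (endo_app J Y) = - bilin_app g X Y) \<and>
     (\<forall>p. \<forall>u\<in>tangent_space A p. \<forall>v\<in>tangent_space A p. G p u v = g p (J p u) v)"

text \<open>The Levi-Civita connection is determined by \<open>g\<close> only as an operation on vector fields, so it
  is bound by an existential quantifier and not by a description operator.\<close>

definition anti_kaehler ::
  "nat \<Rightarrow> ('a::{t2_space,second_countable_topology}, 'e::euclidean_space) atlas \<Rightarrow> 'a endo \<Rightarrow>
     'a bilin \<Rightarrow> 'a bilin \<Rightarrow> bool" where
  "anti_kaehler n A J g G \<longleftrightarrow> almost_anti_hermitian n A J g G \<and>
     (\<exists>D. levi_civita A g D \<and>
        (\<forall>X\<in>vector_fields A. \<forall>Y\<in>vector_fields A. cov_endo D X J Y = 0))"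

end

theory Submission
  imports Defs
begin

text \<open>
  The bridge between the two sides is the tensor
  \<open>\<Phi>(X, Y, Z) = (L\<^bsub>JX\<^esub> g - L\<^bsub>X\<^esub> (g \<circ> J))(Y, Z)\<close>. It is made of Lie brackets, and a torsion-free
  connection \<open>D\<close> writes a bracket as \<open>D\<^bsub>X\<^esub> Y - D\<^bsub>Y\<^esub> X\<close>, so that \<open>\<Phi>\<close> has the same expression in terms of
  \<open>D g\<close> and \<open>D J\<close> for every such \<open>D\<close> (\<open>tachibana_torsion_free\<close>). Two unrelated
  torsion-free connections can therefore be compared by evaluating \<open>\<Phi>\<close> with each of them.

  With the connection of the Codazzi pair, the terms of \<open>\<Phi>\<close> that are skew in \<open>X\<close> and \<open>Y\<close> cancel, and
  since \<open>D\<^bsub>X\<^esub> J\<close> anticommutes with \<open>J\<close>, what remains of \<open>\<Phi>(X, Y, JZ)\<close> is the difference of the two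
  sides of the equation in the theorem (\<open>tachibana_codazzi\<close>). As \<open>J\<close> is onto, that equation holds for
  all fields iff \<open>\<Phi> = 0\<close>. With the Levi-Civita connection \<open>\<nabla>\<close>, only terms in \<open>\<nabla> J\<close> are left, and the
  trilinear form \<open>g((\<nabla>\<^bsub>X\<^esub> J) Y, Z)\<close> is symmetric in \<open>Y\<close> and \<open>Z\<close>; adding two instances of \<open>\<Phi> = 0\<close>
  shows that it vanishes (\<open>parallel_iff_tachibana_zero\<close>). So \<open>\<Phi> = 0\<close> iff \<open>\<nabla> J = 0\<close>.

  An anti-Kaehler manifold is required to have a Levi-Civita connection, so its existence has to be
  established (\<open>levi_civita_exists\<close>). It is \<open>D + S\<close>, where \<open>S\<close> is the tensor determined by
  \<open>2 g(S(X, Y), Z) = (D\<^bsub>X\<^esub> g)(Y, Z) + (D\<^bsub>Y\<^esub> g)(X, Z) - (D\<^bsub>Z\<^esub> g)(X, Y)\<close>. This needs the representation of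
  function-linear forms on vector fields by vector fields (\<open>musical_isomorphism\<close>), that is, smooth
  frames near every point. The frames come from bump functions and from a division-free
  orthogonalisation (\<open>orthogonal_fields\<close>). That the derivations at a point are exactly the
  combinations of coordinate derivatives is a dimension count: the signature bounds the dimension of
  the tangent space by \<open>DIM('e)\<close>, and the coordinate derivatives are independent
  (\<open>injective_onto_tangent_space\<close>, \<open>exists_coordinate_fields\<close>).
\<close>

section \<open>Calculus of \<open>C\<^sup>k\<close> functions\<close>

lemma frechet_derivative_cong_open:
  assumes "open S" "x \<in> S" "\<And>y. y \<in> S \<Longrightarrow> f y = g y"
  shows "frechet_derivative f (at x) = frechet_derivative g (at x)"
proof -
  have "(f has_derivative d) (at x) \<longleftrightarrow> (g has_derivative d) (at x)" for d
    using has_derivative_transform_within_open[OF _ assms(1,2)] assms(3) by metis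
  then show ?thesis by (simp add: frechet_derivative_def)
qed

lemma differentiable_cong_open:
  assumes "open S" "x \<in> S" "\<And>y. y \<in> S \<Longrightarrow> f y = g y" "f differentiable (at x)"
  shows "g differentiable (at x)"
  using assms has_derivative_transform_within_open[OF _ assms(1,2)] unfolding differentiable_def by metis

lemma Ck_on_cong:
  assumes "open S" "\<And>y. y \<in> S \<Longrightarrow> f y = g y" "Ck_on k S f"
  shows "Ck_on k S g"
  using assms(2,3)
proof (induction k arbitrary: f g)
  case 0
  then show ?case by (auto cong: continuous_on_cong)
next
  case (Suc k)
  have "Ck_on k S (\<lambda>x. frechet_derivative g (at x) v)" for v
    using Suc.prems Suc.IH[of "\<lambda>x. frechet_derivative f (at x) v"]
      frechet_derivative_cong_open[OF assms(1), of _ f g] by simp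
  then show ?case
    using Suc.prems differentiable_cong_open[OF assms(1), of _ f g] by auto
qed

lemma Ck_on_subset: "Ck_on k S f \<Longrightarrow> T \<subseteq> S \<Longrightarrow> Ck_on k T f"
  by (induction k arbitrary: f) (auto intro: continuous_on_subset)

text \<open>Both differentiability and the value of \<open>frechet_derivative\<close> at a point refer to a full
  neighbourhood of the point, so gluing needs no compatibility of the pieces.\<close>

lemma Ck_on_local:
  assumes "\<And>x. x \<in> S \<Longrightarrow> \<exists>T. open T \<and> x \<in> T \<and> Ck_on k T f"
  shows "Ck_on k S f"
  using assms
proof (induction k arbitrary: f)
  case 0
  have "isCont f x" if "x \<in> S" for x
    using 0[OF that] continuous_on_eq_continuous_at by auto
  then show ?case by (simp add: continuous_at_imp_continuous_on)
next
  case (Suc k)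
  show ?case
    using Suc.prems by (fastforce intro!: Suc.IH)
qed

lemma Ck_on_continuous: "Ck_on k S f \<Longrightarrow> continuous_on S f"
  by (cases k) (auto intro!: continuous_at_imp_continuous_on differentiable_imp_continuous_within)

lemma Ck_on_SucD: "Ck_on (Suc k) S f \<Longrightarrow> Ck_on k S f"
proof (induction k arbitrary: f)
  case 0
  then show ?case using Ck_on_continuous[of "Suc 0"] by (metis Ck_on.simps(1))
next
  case (Suc k)
  then show ?case by (metis Ck_on.simps(2))
qed

lemma Ck_on_const: "Ck_on k S (\<lambda>x. c)"
  by (induction k arbitrary: c) (auto simp: frechet_derivative_const)

lemma Ck_on_bounded_linear:
  assumes "bounded_linear h"
  shows "Ck_on k S h"
proof (cases k)
  case (Suc m)
  have d: "(h has_derivative h) (at x)" for x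
    by (rule bounded_linear_imp_has_derivative[OF assms])
  show ?thesis
    unfolding Suc using d by (auto simp: Ck_on_const differentiable_def frechet_derivative_at[OF d, symmetric])
qed (auto intro: linear_continuous_on assms)

text \<open>Inductions on the order produce an explicit derivative, which agrees with \<open>frechet_derivative\<close>
  on \<open>S\<close> only; openness of \<open>S\<close> makes this harmless for the higher derivatives.\<close>

lemma Ck_on_SucI:
  assumes "open S" "\<And>x. x \<in> S \<Longrightarrow> (f has_derivative d x) (at x)"
    and "\<And>v. Ck_on k S (\<lambda>x. d x v)"
  shows "Ck_on (Suc k) S f"
proof -
  have "frechet_derivative f (at x) = d x" if "x \<in> S" for x
    using frechet_derivative_at[OF assms(2)[OF that]] by simp
  then have "Ck_on k S (\<lambda>x. frechet_derivative f (at x) v)" for v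
    using Ck_on_cong[OF assms(1) _ assms(3)] by simp
  then show ?thesis using assms(2) by (auto simp: differentiable_def)
qed

lemma Ck_on_has_derivative:
  "Ck_on (Suc k) S f \<Longrightarrow> x \<in> S \<Longrightarrow> (f has_derivative frechet_derivative f (at x)) (at x)"
  by (simp add: frechet_derivative_works[symmetric])

lemma Ck_on_compose_bounded_linear:
  assumes "bounded_linear h" "open S" "Ck_on k S f"
  shows "Ck_on k S (\<lambda>x. h (f x))"
  using assms(3)
proof (induction k arbitrary: f)
  case 0
  then show ?case using bounded_linear.continuous_on[OF assms(1)] by simp
next
  case (Suc k)
  have *: "Ck_on k S (\<lambda>x. h (frechet_derivative f (at x) v))" for v
    using Suc.prems by (intro Suc.IH) simp
  show ?case
    by (rule Ck_on_SucI[OF assms(2)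
          bounded_linear.has_derivative[OF assms(1) Ck_on_has_derivative[OF Suc.prems]] *])
qed

lemma Ck_on_add:
  assumes "open S" "Ck_on k S f" "Ck_on k S g"
  shows "Ck_on k S (\<lambda>x. f x + g x)"
  using assms(2,3)
proof (induction k arbitrary: f g)
  case 0
  then show ?case by (auto intro: continuous_intros)
next
  case (Suc k)
  have *: "Ck_on k S (\<lambda>x. frechet_derivative f (at x) v + frechet_derivative g (at x) v)" for v
    using Suc.prems by (intro Suc.IH) simp_all
  show ?case
    by (rule Ck_on_SucI[OF assms(1) has_derivative_add[OF Ck_on_has_derivative[OF Suc.prems(1)]
            Ck_on_has_derivative[OF Suc.prems(2)]] *])
qed

lemma Ck_on_mult:
  fixes f g :: "'e::euclidean_space \<Rightarrow> real"
  assumes "open S" "Ck_on k S f" "Ck_on k S g"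
  shows "Ck_on k S (\<lambda>x. f x * g x)"
  using assms(2,3)
proof (induction k arbitrary: f g)
  case 0
  then show ?case by (auto intro: continuous_intros)
next
  case (Suc k)
  have *: "Ck_on k S (\<lambda>x. f x * frechet_derivative g (at x) v + frechet_derivative f (at x) v * g x)" for v
    using Suc.prems Suc.prems[THEN Ck_on_SucD] by (intro Ck_on_add[OF assms(1)] Suc.IH) simp_all
  show ?case
    by (rule Ck_on_SucI[OF assms(1) has_derivative_mult[OF Ck_on_has_derivative[OF Suc.prems(1)]
            Ck_on_has_derivative[OF Suc.prems(2)]] *])
qed

lemma Ck_on_sum:
  assumes "open S" "\<And>i. i \<in> I \<Longrightarrow> Ck_on k S (f i)"
  shows "Ck_on k S (\<lambda>x. \<Sum>i\<in>I. f i x)"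
  using assms(2)
  by (induction I rule: infinite_finite_induct) (auto intro: Ck_on_const Ck_on_add[OF assms(1)])

lemma Ck_on_inverse:
  fixes f :: "'e::euclidean_space \<Rightarrow> real"
  assumes "open S" "Ck_on k S f" "\<And>x. x \<in> S \<Longrightarrow> f x \<noteq> 0"
  shows "Ck_on k S (\<lambda>x. inverse (f x))"
  using assms(2)
proof (induction k)
  case 0
  then show ?case using assms(3) continuous_on_inverse[of S f] by simp
next
  case (Suc k)
  have 1: "((\<lambda>x. inverse (f x)) has_derivative
      (\<lambda>v. - (inverse (f x) * frechet_derivative f (at x) v * inverse (f x)))) (at x)" if "x \<in> S" for x
    by (rule Deriv.has_derivative_inverse[OF assms(3)[OF that] Ck_on_has_derivative[OF Suc.prems that]])
  have 2: "Ck_on k S (\<lambda>x. inverse (f x))" using Suc Ck_on_SucD by blast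
  have 3: "Ck_on k S (\<lambda>x. frechet_derivative f (at x) v)" for v using Suc.prems by simp
  have 4: "Ck_on k S (\<lambda>x. - (inverse (f x) * frechet_derivative f (at x) v * inverse (f x)))" for v
    by (intro Ck_on_compose_bounded_linear[OF bounded_linear_minus[OF bounded_linear_ident]] Ck_on_mult assms(1) 2 3)
  show ?case
    by (rule Ck_on_SucI[OF assms(1) 1 4])
qed

text \<open>Expanded in a basis, the chain rule writes a derivative of \<open>f \<circ> u\<close> as a sum of products of
  \<open>C\<^sup>k\<close> functions with compositions of lower order.\<close>

lemma Ck_on_compose:
  fixes f :: "'e::euclidean_space \<Rightarrow> real" and u :: "'d::euclidean_space \<Rightarrow> 'e"
  assumes "open S" "Ck_on k T f" "Ck_on k S u" "u ` S \<subseteq> T"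
  shows "Ck_on k S (f \<circ> u)"
  using assms(2,3)
proof (induction k arbitrary: f)
  case 0
  then show ?case using assms(4) continuous_on_compose continuous_on_subset by (metis Ck_on.simps(1))
next
  case (Suc k)
  define d where "d x v = (\<Sum>b\<in>Basis. (frechet_derivative u (at x) v \<bullet> b) * (((\<lambda>y. frechet_derivative f (at y) b) \<circ> u) x))"
    for x v
  have 1: "(f \<circ> u has_derivative d x) (at x)" if "x \<in> S" for x
  proof -
    have du: "(u has_derivative frechet_derivative u (at x)) (at x)"
      using Ck_on_has_derivative[OF Suc.prems(2) that] .
    have df: "(f has_derivative frechet_derivative f (at (u x))) (at (u x))"
      using Ck_on_has_derivative[OF Suc.prems(1)] that assms(4) by blast
    have "frechet_derivative f (at (u x)) (frechet_derivative u (at x) v) = d x v" for v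
      unfolding d_def o_def
      using Linear_Algebra.linear_componentwise[OF has_derivative_linear[OF df], of "frechet_derivative u (at x) v" 1]
      by (simp only: inner_real_def mult_1_right)
    then have "d x = frechet_derivative f (at (u x)) \<circ> frechet_derivative u (at x)"
      by (simp add: fun_eq_iff)
    then show ?thesis using diff_chain_at[OF du df] by simp
  qed
  have 2: "Ck_on k S (\<lambda>x. d x v)" for v
    unfolding d_def
  proof (intro Ck_on_sum[OF assms(1)] Ck_on_mult[OF assms(1)])
    fix b :: 'e
    have "Ck_on k S (\<lambda>x. frechet_derivative u (at x) v)" using Suc.prems(2) by simp
    then show "Ck_on k S (\<lambda>x. frechet_derivative u (at x) v \<bullet> b)"
      by (rule Ck_on_compose_bounded_linear[OF bounded_linear_inner_left assms(1)])
    have "Ck_on k T (\<lambda>y. frechet_derivative f (at y) b)" using Suc.prems(1) by simp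
    from Suc.IH[OF this Ck_on_SucD[OF Suc.prems(2)]]
    show "Ck_on k S (\<lambda>x. ((\<lambda>y. frechet_derivative f (at y) b) \<circ> u) x)" by (simp only: o_def)
  qed
  show ?case by (rule Ck_on_SucI[OF assms(1) 1 2])
qed

section \<open>Bump functions\<close>

text \<open>The powers of \<open>1 / t\<close> are there because the derivative of one member of the family is a combination
  of others, which turns smoothness into an induction over all members at once.\<close>

definition flat :: "nat \<Rightarrow> real \<Rightarrow> real" where
  "flat m t = (if t > 0 then inverse t ^ m * exp (- inverse t) else 0)"

text \<open>The substitution \<open>t \<mapsto> 1 / t\<close> reduces this to the growth of the exponential.\<close>

lemma flat_tendsto_0: "(flat m \<longlongrightarrow> 0) (at 0)"
proof -
  have "((\<lambda>t. t ^ m / exp t) \<longlongrightarrow> (0::real)) at_top"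
    by (rule tendsto_power_div_exp_0)
  then have "((\<lambda>t. inverse t ^ m / exp (inverse t)) \<longlongrightarrow> (0::real)) (at_right 0)"
    using filterlim_compose filterlim_inverse_at_top_right by blast
  then have "(flat m \<longlongrightarrow> 0) (at_right 0)"
    by (rule Lim_transform_eventually)
      (auto simp: flat_def exp_minus divide_inverse eventually_at_filter)
  moreover have "(flat m \<longlongrightarrow> 0) (at_left 0)"
    by (rule Lim_transform_eventually[OF tendsto_const])
      (auto simp: flat_def eventually_at_filter)
  ultimately show ?thesis by (rule filterlim_split_at_real[rotated])
qed

text \<open>At \<open>0\<close> the difference quotient of \<open>flat m\<close> is \<open>flat (m + 1)\<close>.\<close>

lemma flat_has_derivative:
  "(flat m has_real_derivative (flat (m + 2) t - m * flat (m + 1) t)) (at t)"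
proof (cases t "0::real" rule: linorder_cases)
  case less
  show ?thesis
    by (rule has_field_derivative_transform_within_open[where S = "{..<0}" and f = "\<lambda>_. 0"])
      (use less in \<open>auto simp: flat_def\<close>)
next
  case equal
  have "((\<lambda>h. flat m h / h) \<longlongrightarrow> 0) (at 0)"
    by (rule Lim_transform_eventually[OF flat_tendsto_0[of "Suc m"]])
      (auto simp: flat_def eventually_at_filter divide_inverse)
  then show ?thesis
    unfolding equal DERIV_def by (simp add: flat_def)
next
  case greater
  \<comment> \<open>The power rule leaves an exponent \<open>n - 1\<close>, truncated at \<open>n = 0\<close>, with factor \<open>n\<close>.\<close>
  have pow: "t ^ n \<noteq> t * t ^ (n - Suc 0) \<Longrightarrow> n = 0" for n by (cases n) auto
  have "((\<lambda>t. inverse t ^ m * exp (- inverse t)) has_real_derivative (flat (m + 2) t - m * flat (m + 1) t)) (at t)"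
    using greater
    by (cases m) (auto intro!: derivative_eq_intros simp: flat_def field_simps power2_eq_square dest: pow)
  then show ?thesis
    by (rule has_field_derivative_transform_within_open[where S = "{0<..}"])
      (use greater in \<open>auto simp: flat_def\<close>)
qed

lemma Ck_on_flat: "Ck_on k UNIV (flat m)"
proof (induction k arbitrary: m)
  case 0
  have "isCont (flat m) t" for t by (rule DERIV_isCont[OF flat_has_derivative])
  then show ?case by (simp add: continuous_at_imp_continuous_on)
next
  case (Suc k)
  have "Ck_on k UNIV (\<lambda>x. (flat (m + 2) x + (- real m) * flat (m + 1) x) * v)" for v
    by (intro Ck_on_add Ck_on_mult Ck_on_const Suc open_UNIV)
  then show ?case
    using flat_has_derivative[of m]
    by (intro Ck_on_SucI[where d = "\<lambda>x v. (flat (m + 2) x - m * flat (m + 1) x) * v"])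
      (auto simp: has_field_derivative_def mult_commute_abs)
qed

text \<open>The function \<open>t \<mapsto> exp (- 1 / t)\<close>, zero for \<open>t \<le> 0\<close>, composed with \<open>r\<^sup>2 - |x - c|\<^sup>2\<close>.\<close>

lemma exists_smooth_bump:
  fixes c :: "'e::euclidean_space"
  assumes "r > 0"
  shows "\<exists>\<rho>::'e \<Rightarrow> real. smooth_on UNIV \<rho> \<and> \<rho> c \<noteq> 0 \<and> (\<forall>x. x \<notin> cball c r \<longrightarrow> \<rho> x = 0)"
proof (intro exI conjI)
  let ?u = "\<lambda>x. r\<^sup>2 + (-1) * (\<Sum>b\<in>Basis. (x \<bullet> b + - (c \<bullet> b)) * (x \<bullet> b + - (c \<bullet> b)))"
  have u: "?u x = r\<^sup>2 - (dist c x)\<^sup>2" for x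
    using euclidean_inner[of "x - c" "x - c"]
    by (simp add: dist_norm norm_minus_commute[of c x] power2_norm_eq_inner inner_diff_left)
  show "smooth_on UNIV (flat 0 \<circ> ?u)"
    unfolding smooth_on_def
    by (intro allI Ck_on_compose[where T = UNIV] Ck_on_flat Ck_on_add Ck_on_mult Ck_on_sum Ck_on_const
        Ck_on_bounded_linear bounded_linear_inner_left open_UNIV subset_UNIV)
  show "(flat 0 \<circ> ?u) c \<noteq> 0" using assms by (simp add: flat_def)
  show "\<forall>x. x \<notin> cball c r \<longrightarrow> (flat 0 \<circ> ?u) x = 0"
  proof (intro allI impI)
    fix x assume "x \<notin> cball c r"
    then have "r\<^sup>2 < (dist c x)\<^sup>2" using assms by (intro power_strict_mono) auto
    then have "?u x < 0" using u by simp
    then show "(flat 0 \<circ> ?u) x = 0" by (simp add: flat_def)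
  qed
qed

section \<open>Smooth functions on open sets\<close>

lemma smooth_onD: "smooth_on S f \<Longrightarrow> Ck_on k S f"
  by (simp add: smooth_on_def)

lemma smooth_on_derivative:
  "smooth_on S f \<Longrightarrow> smooth_on S (\<lambda>x. frechet_derivative f (at x) v)"
  unfolding smooth_on_def by (metis Ck_on.simps(2))

lemma smooth_on_has_derivative:
  "smooth_on S f \<Longrightarrow> x \<in> S \<Longrightarrow> (f has_derivative frechet_derivative f (at x)) (at x)"
  by (rule Ck_on_has_derivative[OF smooth_onD])

lemma smooth_on_add:
  "open S \<Longrightarrow> smooth_on S f \<Longrightarrow> smooth_on S g \<Longrightarrow> smooth_on S (\<lambda>x. f x + g x)"
  by (simp add: smooth_on_def Ck_on_add)

lemma smooth_on_mult:
  fixes f g :: "'e::euclidean_space \<Rightarrow> real"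
  shows "open S \<Longrightarrow> smooth_on S f \<Longrightarrow> smooth_on S g \<Longrightarrow> smooth_on S (\<lambda>x. f x * g x)"
  by (simp add: smooth_on_def Ck_on_mult)

lemma smooth_on_inverse:
  fixes f :: "'e::euclidean_space \<Rightarrow> real"
  shows "open S \<Longrightarrow> smooth_on S f \<Longrightarrow> (\<And>x. x \<in> S \<Longrightarrow> f x \<noteq> 0) \<Longrightarrow> smooth_on S (\<lambda>x. inverse (f x))"
  by (simp add: smooth_on_def Ck_on_inverse)

lemma smooth_on_subset: "smooth_on S f \<Longrightarrow> T \<subseteq> S \<Longrightarrow> smooth_on T f"
  unfolding smooth_on_def by (blast intro: Ck_on_subset)

lemma smooth_on_local:
  assumes "\<And>x. x \<in> S \<Longrightarrow> \<exists>T. open T \<and> x \<in> T \<and> smooth_on T f"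
  shows "smooth_on S f"
  unfolding smooth_on_def using assms by (intro allI Ck_on_local) (metis smooth_on_def)

lemma smooth_on_cong:
  assumes "open S" "smooth_on S f" "\<And>y. y \<in> S \<Longrightarrow> f y = g y"
  shows "smooth_on S g"
  using assms(2) unfolding smooth_on_def by (auto intro: Ck_on_cong[OF assms(1), of f g] assms(3))

section \<open>Smooth functions on a manifold\<close>

lemma inj_on_chart: "smooth_atlas A \<Longrightarrow> (U, \<phi>) \<in> A \<Longrightarrow> inj_on \<phi> U"
  unfolding smooth_atlas_def homeomorphism_def by (fastforce intro: inj_on_inverseI)

lemma chart_cover:
  assumes "smooth_atlas A" obtains U \<phi> where "(U, \<phi>) \<in> A" "p \<in> U"
  using assms unfolding smooth_atlas_def by blast

lemma open_chart_domain: "smooth_atlas A \<Longrightarrow> (U, \<phi>) \<in> A \<Longrightarrow> open U"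
  unfolding smooth_atlas_def by blast

lemma open_chart_range: "smooth_atlas A \<Longrightarrow> (U, \<phi>) \<in> A \<Longrightarrow> open (\<phi> ` U)"
  unfolding smooth_atlas_def by blast

lemma chart_homeomorphism:
  assumes "smooth_atlas A" "(U, \<phi>) \<in> A"
  shows "homeomorphism U (\<phi> ` U) \<phi> (inv_into U \<phi>)"
proof -
  obtain \<psi> where h: "homeomorphism U (\<phi> ` U) \<phi> \<psi>"
    using assms unfolding smooth_atlas_def by blast
  have eq: "\<psi> y = inv_into U \<phi> y" if y: "y \<in> \<phi> ` U" for y
  proof -
    obtain q where "q \<in> U" "y = \<phi> q" using y by blast
    then show ?thesis
      by (simp add: inv_into_f_f[OF inj_on_chart[OF assms]] homeomorphism_apply1[OF h])
  qed
  show ?thesis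
    by (rule homeomorphism_cong[OF h refl refl refl eq[symmetric]])
qed

lemma open_chart_image:
  assumes "smooth_atlas A" "(U, \<phi>) \<in> A" "open W"
  shows "open (\<phi> ` (U \<inter> W))"
proof -
  have "openin (top_of_set (\<phi> ` U)) (\<phi> ` (U \<inter> W))"
    by (rule homeomorphism_imp_open_map[OF chart_homeomorphism[OF assms(1,2)] openin_open_Int[OF assms(3)]])
  then show ?thesis using open_chart_range[OF assms(1,2)] openin_open_eq by blast
qed

lemma smooth_funD: "smooth_fun A f \<Longrightarrow> (U, \<phi>) \<in> A \<Longrightarrow> smooth_on (\<phi> ` U) (f \<circ> inv_into U \<phi>)"
  unfolding smooth_fun_def by blast

lemma smooth_fun_const: "smooth_fun A (\<lambda>_. c)"
  by (auto simp: smooth_fun_def smooth_on_def o_def Ck_on_const)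

lemma smooth_fun_add:
  assumes "smooth_atlas A" "smooth_fun A f" "smooth_fun A h"
  shows "smooth_fun A (f + h)"
  unfolding smooth_fun_def
proof clarify
  fix U \<phi> assume c: "(U, \<phi>) \<in> A"
  show "smooth_on (\<phi> ` U) ((f + h) \<circ> inv_into U \<phi>)"
    using smooth_on_add[OF open_chart_range[OF assms(1) c] smooth_funD[OF assms(2) c] smooth_funD[OF assms(3) c]]
    by (simp add: o_def)
qed

lemma smooth_fun_mult:
  assumes "smooth_atlas A" "smooth_fun A f" "smooth_fun A h"
  shows "smooth_fun A (f * h)"
  unfolding smooth_fun_def
proof clarify
  fix U \<phi> assume c: "(U, \<phi>) \<in> A"
  show "smooth_on (\<phi> ` U) ((f * h) \<circ> inv_into U \<phi>)"
    using smooth_on_mult[OF open_chart_range[OF assms(1) c] smooth_funD[OF assms(2) c] smooth_funD[OF assms(3) c]]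
    by (simp add: o_def)
qed

lemma smooth_fun_uminus: "smooth_atlas A \<Longrightarrow> smooth_fun A f \<Longrightarrow> smooth_fun A (- f)"
  using smooth_fun_mult[OF _ smooth_fun_const, of A f "-1"] by (simp add: times_fun_def fun_Compl_def)

lemma smooth_fun_diff:
  "smooth_atlas A \<Longrightarrow> smooth_fun A f \<Longrightarrow> smooth_fun A h \<Longrightarrow> smooth_fun A (f - h)"
  using smooth_fun_add[OF _ _ smooth_fun_uminus, of A f h] by simp

lemma smooth_fun_sum:
  "smooth_atlas A \<Longrightarrow> (\<And>i. i \<in> I \<Longrightarrow> smooth_fun A (f i)) \<Longrightarrow> smooth_fun A (\<Sum>i\<in>I. f i)"
  by (induction I rule: infinite_finite_induct)
    (auto simp: zero_fun_def smooth_fun_const smooth_fun_add)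

lemma smooth_fun_prod:
  "smooth_atlas A \<Longrightarrow> (\<And>i. i \<in> I \<Longrightarrow> smooth_fun A (f i)) \<Longrightarrow> smooth_fun A (\<Prod>i\<in>I. f i)"
  by (induction I rule: infinite_finite_induct)
    (auto simp: one_fun_def smooth_fun_const smooth_fun_mult)

text \<open>Frames exist only near a point, but with denominators cleared their expansions hold globally. Near
  a point where \<open>b\<close> does not vanish, \<open>f\<close> is the quotient of the smooth functions \<open>a\<close> and \<open>b\<close>.\<close>

lemma smooth_fun_local_quotient:
  assumes A: "smooth_atlas A"
    and ab: "\<And>p. \<exists>a b. smooth_fun A a \<and> smooth_fun A b \<and> b p \<noteq> 0 \<and> b * f = a"
  shows "smooth_fun A f"
  unfolding smooth_fun_def
proof clarify
  fix U \<phi> assume c: "(U, \<phi>) \<in> A"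
  let ?i = "inv_into U \<phi>"
  show "smooth_on (\<phi> ` U) (f \<circ> ?i)"
  proof (rule smooth_on_local)
    fix x assume x: "x \<in> \<phi> ` U"
    obtain a b where ab: "smooth_fun A a" "smooth_fun A b" "b (?i x) \<noteq> 0" "b * f = a"
      using ab by blast
    have sa: "smooth_on (\<phi> ` U) (a \<circ> ?i)" and sb: "smooth_on (\<phi> ` U) (b \<circ> ?i)"
      using smooth_funD[OF _ c] ab by auto
    define T where "T = {y \<in> \<phi> ` U. (b \<circ> ?i) y \<noteq> 0}"
    have "T = (b \<circ> ?i) -` (- {0}) \<inter> \<phi> ` U" by (auto simp: T_def)
    moreover have "open \<dots>"
      using Ck_on_continuous[OF smooth_onD[OF sb]] continuous_on_open_vimage[OF open_chart_range[OF A c]]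
      by blast
    ultimately have "open T" by simp
    have "smooth_on T (\<lambda>y. (a \<circ> ?i) y * inverse ((b \<circ> ?i) y))"
      by (intro smooth_on_mult smooth_on_inverse smooth_on_subset[OF sa] smooth_on_subset[OF sb] \<open>open T\<close>)
        (auto simp: T_def)
    then have "smooth_on T (f \<circ> ?i)"
      by (rule smooth_on_cong[OF \<open>open T\<close>]) (use ab(4) in \<open>auto simp: T_def\<close>)
    moreover have "x \<in> T" using x ab by (simp add: T_def)
    ultimately show "\<exists>T. open T \<and> x \<in> T \<and> smooth_on T (f \<circ> ?i)"
      using \<open>open T\<close> by blast
  qed
qed

text \<open>Outside the chart domain the function vanishes near every point, because the compact set that
  carries it stays closed in the manifold; this is where the Hausdorff property enters.\<close>

lemma smooth_fun_extend_by_zero: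
  assumes A: "smooth_atlas A" and c: "(U, \<phi>) \<in> A" and F: "smooth_on (\<phi> ` U) F"
    and K: "compact K" "K \<subseteq> \<phi> ` U" "\<And>y. y \<in> \<phi> ` U - K \<Longrightarrow> F y = 0"
  shows "smooth_fun A (\<lambda>q. if q \<in> U then F (\<phi> q) else 0)" (is "smooth_fun A ?f")
  unfolding smooth_fun_def
proof clarify
  fix V \<psi> assume d: "(V, \<psi>) \<in> A"
  let ?i = "inv_into V \<psi>"
  have "compact (inv_into U \<phi> ` K)"
    using chart_homeomorphism[OF A c] K(1,2)
    by (meson compact_continuous_image continuous_on_subset homeomorphism_def)
  then have op: "open (- inv_into U \<phi> ` K)"
    by (simp add: compact_imp_closed open_Compl)
  show "smooth_on (\<psi> ` V) (?f \<circ> ?i)"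
  proof (rule smooth_on_local)
    fix x assume x: "x \<in> \<psi> ` V"
    have xV: "?i x \<in> V" "\<psi> (?i x) = x" using x by (auto intro: inv_into_into f_inv_into_f)
    show "\<exists>T. open T \<and> x \<in> T \<and> smooth_on T (?f \<circ> ?i)"
    proof (cases "?i x \<in> U")
      case True
      let ?T = "\<psi> ` (V \<inter> U)"
      have oT: "open ?T" using open_chart_image[OF A d open_chart_domain[OF A c]] .
      have t: "smooth_on ?T (\<phi> \<circ> ?i)" using A c d unfolding smooth_atlas_def by blast
      have mem: "?i y \<in> U" if "y \<in> ?T" for y
        using that inj_on_chart[OF A d] by auto
      have "smooth_on ?T (F \<circ> (\<phi> \<circ> ?i))"
        unfolding smooth_on_def
        by (intro allI Ck_on_compose[OF oT smooth_onD[OF F] smooth_onD[OF t]]) (use mem in auto)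
      then have "smooth_on ?T (?f \<circ> ?i)"
        by (rule smooth_on_cong[OF oT]) (use mem in auto)
      moreover have "x \<in> ?T" using True xV by (metis IntI imageI)
      ultimately show ?thesis using oT by blast
    next
      case False
      let ?T = "\<psi> ` (V \<inter> - inv_into U \<phi> ` K)"
      have oT: "open ?T" using open_chart_image[OF A d op] .
      have z: "(?f \<circ> ?i) y = 0" if "y \<in> ?T" for y
      proof -
        obtain q where q: "q \<in> V" "q \<notin> inv_into U \<phi> ` K" "y = \<psi> q" using \<open>y \<in> ?T\<close> by auto
        have "?i y = q" using q inj_on_chart[OF A d] by simp
        moreover have "\<phi> q \<notin> K" if "q \<in> U"
          using q(2) that inj_on_chart[OF A c] by (metis image_eqI inv_into_f_f)
        ultimately show ?thesis using K(3) by auto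
      qed
      have "smooth_on ?T (\<lambda>_. 0 :: real)" by (simp add: smooth_on_def Ck_on_const)
      then have sm: "smooth_on ?T (?f \<circ> ?i)"
        by (rule smooth_on_cong[OF oT]) (simp only: z)
      have "?i x \<notin> inv_into U \<phi> ` K" using False K(2) by (metis imageE inv_into_into subsetD)
      then have "\<psi> (?i x) \<in> ?T" using xV(1) by blast
      then have "x \<in> ?T" using xV(2) by simp
      then show ?thesis using oT sm by blast
    qed
  qed
qed

section \<open>Tangent vectors and vector fields\<close>

lemma sum_fun_apply: "(\<Sum>i\<in>I. f i) x = (\<Sum>i\<in>I. f i x)"
  by (induction I rule: infinite_finite_induct) auto

lemma tangent_add: "u \<in> tangent_space A p \<Longrightarrow> v \<in> tangent_space A p \<Longrightarrow> u + v \<in> tangent_space A p"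
  by (simp add: tangent_space_def algebra_simps)

lemma tangent_scale: "u \<in> tangent_space A p \<Longrightarrow> tscale c u \<in> tangent_space A p"
  by (simp add: tangent_space_def tscale_def algebra_simps)

lemma tangent_zero: "0 \<in> tangent_space A p"
  by (simp add: tangent_space_def)

lemma uminus_eq_tscale: "- u = tscale (- 1) u"
  by (simp add: tscale_def fun_eq_iff)

lemma tangent_uminus: "u \<in> tangent_space A p \<Longrightarrow> - u \<in> tangent_space A p"
  by (simp add: uminus_eq_tscale tangent_scale)

lemma tangent_diff: "u \<in> tangent_space A p \<Longrightarrow> v \<in> tangent_space A p \<Longrightarrow> u - v \<in> tangent_space A p"
  using tangent_add[OF _ tangent_uminus, of u A p v] by simp

lemma tangent_sum: "(\<And>i. i \<in> I \<Longrightarrow> u i \<in> tangent_space A p) \<Longrightarrow> (\<Sum>i\<in>I. u i) \<in> tangent_space A p"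
  by (induction I rule: infinite_finite_induct) (auto intro: tangent_zero tangent_add)

lemma field_tangent: "X \<in> vector_fields A \<Longrightarrow> X p \<in> tangent_space A p"
  by (simp add: vector_fields_def)

lemma field_smooth: "X \<in> vector_fields A \<Longrightarrow> smooth_fun A f \<Longrightarrow> smooth_fun A (\<lambda>p. X p f)"
  by (simp add: vector_fields_def)

lemma field_add:
  assumes "smooth_atlas A" "X \<in> vector_fields A" "Y \<in> vector_fields A"
  shows "X + Y \<in> vector_fields A"
  unfolding vector_fields_def
proof (intro CollectI conjI allI impI)
  fix p show "(X + Y) p \<in> tangent_space A p"
    using tangent_add[OF field_tangent[OF assms(2)] field_tangent[OF assms(3)]] by simp
next
  fix h assume "smooth_fun A h"
  then have "smooth_fun A ((\<lambda>p. X p h) + (\<lambda>p. Y p h))"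
    by (intro smooth_fun_add assms(1) field_smooth[OF assms(2)] field_smooth[OF assms(3)])
  then show "smooth_fun A (\<lambda>p. (X + Y) p h)"
    by (simp add: plus_fun_def)
qed

lemma field_fscale:
  assumes "smooth_atlas A" "X \<in> vector_fields A" "smooth_fun A f"
  shows "fscale f X \<in> vector_fields A"
  unfolding vector_fields_def
proof (intro CollectI conjI allI impI)
  fix p show "fscale f X p \<in> tangent_space A p"
    using tangent_scale[OF field_tangent[OF assms(2)]] by (simp add: fscale_def)
next
  fix h assume "smooth_fun A h"
  then have "smooth_fun A (f * (\<lambda>p. X p h))"
    by (intro smooth_fun_mult assms(1,3) field_smooth[OF assms(2)])
  then show "smooth_fun A (\<lambda>p. fscale f X p h)"
    by (simp add: fscale_def tscale_def times_fun_def)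
qed

lemma uminus_eq_fscale: "- X = fscale (\<lambda>_. - 1) X"
  by (simp add: fscale_def tscale_def fun_eq_iff)

lemma field_uminus: "smooth_atlas A \<Longrightarrow> X \<in> vector_fields A \<Longrightarrow> - X \<in> vector_fields A"
  by (simp add: uminus_eq_fscale field_fscale smooth_fun_const)

lemma field_diff:
  "smooth_atlas A \<Longrightarrow> X \<in> vector_fields A \<Longrightarrow> Y \<in> vector_fields A \<Longrightarrow> X - Y \<in> vector_fields A"
  using field_add[OF _ _ field_uminus, of A X Y] by simp

lemma field_zero: "0 \<in> vector_fields A"
  by (auto simp: vector_fields_def tangent_zero smooth_fun_const)

text \<open>In the chart \<open>(U, \<phi>)\<close> this is \<open>\<rho> \<partial>\<^sub>v\<close>. It is zero on non-smooth functions by the convention for tangent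
  vectors.\<close>

definition cutoff_coordinate_field ::
  "('a::{t2_space,second_countable_topology}, 'e::euclidean_space) atlas \<Rightarrow> 'a set \<Rightarrow> ('a \<Rightarrow> 'e) \<Rightarrow>
    ('e \<Rightarrow> real) \<Rightarrow> 'e \<Rightarrow> 'a vfield" where
  "cutoff_coordinate_field A U \<phi> \<rho> v = (\<lambda>q f. if smooth_fun A f \<and> q \<in> U
     then \<rho> (\<phi> q) * frechet_derivative (f \<circ> inv_into U \<phi>) (at (\<phi> q)) v else 0)"

text \<open>The Leibniz rule in a chart gives a derivation at each point, and the cutoff makes its extension by
  zero smooth.\<close>

lemma cutoff_coordinate_field:
  assumes A: "smooth_atlas A" and c: "(U, \<phi>) \<in> A" and \<rho>: "smooth_on UNIV \<rho>"
    and K: "compact K" "K \<subseteq> \<phi> ` U" "\<And>y. y \<notin> K \<Longrightarrow> \<rho> y = 0"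
  shows "cutoff_coordinate_field A U \<phi> \<rho> v \<in> vector_fields A"
  unfolding vector_fields_def
proof (intro CollectI conjI allI impI)
  fix f assume f: "smooth_fun A f"
  have "smooth_on (\<phi> ` U) (\<lambda>y. \<rho> y * frechet_derivative (f \<circ> inv_into U \<phi>) (at y) v)"
    by (intro smooth_on_mult open_chart_range[OF A c] smooth_on_subset[OF \<rho>] smooth_on_derivative
        smooth_funD[OF f c]) auto
  from smooth_fun_extend_by_zero[OF A c this K(1,2)] K(3)
  show "smooth_fun A (\<lambda>p. cutoff_coordinate_field A U \<phi> \<rho> v p f)"
    using f by (simp add: cutoff_coordinate_field_def)
next
  fix q
  let ?i = "inv_into U \<phi>" and ?d = "\<lambda>f. frechet_derivative (f \<circ> inv_into U \<phi>) (at (\<phi> q))"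
  show "cutoff_coordinate_field A U \<phi> \<rho> v q \<in> tangent_space A q"
  proof (cases "q \<in> U")
    case False
    then show ?thesis by (simp add: cutoff_coordinate_field_def tangent_space_def)
  next
    case True
    have iq: "?i (\<phi> q) = q" using inj_on_chart[OF A c] True by simp
    have d: "(f \<circ> ?i has_derivative ?d f) (at (\<phi> q))" if "smooth_fun A f" for f
      using smooth_on_has_derivative[OF smooth_funD[OF that c]] True by blast
    have add: "?d (f + h) v = ?d f v + ?d h v" if "smooth_fun A f" "smooth_fun A h" for f h
    proof -
      have "((f + h) \<circ> ?i has_derivative (\<lambda>v. ?d f v + ?d h v)) (at (\<phi> q))"
        using has_derivative_add[OF d[OF that(1)] d[OF that(2)]] by (simp add: o_def)
      from frechet_derivative_at[OF this, symmetric] show ?thesis by simp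
    qed
    have mult: "?d (f * h) v = ?d f v * h q + f q * ?d h v" if "smooth_fun A f" "smooth_fun A h" for f h
    proof -
      have "((f * h) \<circ> ?i has_derivative (\<lambda>v. f q * ?d h v + ?d f v * h q)) (at (\<phi> q))"
        using has_derivative_mult[OF d[OF that(1)] d[OF that(2)]] by (simp add: o_def iq)
      from frechet_derivative_at[OF this, symmetric] show ?thesis by simp
    qed
    have cm: "smooth_fun A (\<lambda>q. a * f q)" if "smooth_fun A f" for a f
      using smooth_fun_mult[OF A smooth_fun_const that] by (simp add: times_fun_def)
    have cmult: "?d (\<lambda>q. a * f q) v = a * ?d f v" if "smooth_fun A f" for a f
    proof -
      have "((\<lambda>q. a * f q) \<circ> ?i has_derivative (\<lambda>v. a * ?d f v)) (at (\<phi> q))"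
        using has_derivative_mult_right[OF d[OF that], of a] by (simp add: o_def)
      from frechet_derivative_at[OF this, symmetric] show ?thesis by simp
    qed
    show ?thesis
      unfolding tangent_space_def cutoff_coordinate_field_def
      using True by (simp add: smooth_fun_add[OF A] smooth_fun_mult[OF A] cm add mult cmult algebra_simps)
  qed
qed

text \<open>The cutoff coordinate fields, with the cutoff nonzero at \<open>p\<close>. They are independent at \<open>p\<close> because
  \<open>E v\<close> does not annihilate the cut-off linear coordinate \<open>y \<mapsto> (y - \<phi> p) \<bullet> v\<close> unless \<open>v = 0\<close>.\<close>

lemma exists_coordinate_fields:
  fixes A :: "('a::{t2_space,second_countable_topology}, 'e::euclidean_space) atlas"
  assumes A: "smooth_atlas A"
  shows "\<exists>E::'e \<Rightarrow> 'a vfield. (\<forall>v. E v \<in> vector_fields A) \<and> (\<forall>v w. E (v + w) p = E v p + E w p) \<and>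
    (\<forall>c v. E (c *\<^sub>R v) p = tscale c (E v p)) \<and> (\<forall>v. E v p = 0 \<longrightarrow> v = 0)"
proof -
  obtain U \<phi> where c: "(U, \<phi>) \<in> A" and p: "p \<in> U" using chart_cover[OF A] .
  let ?i = "inv_into U \<phi>"
  have ip: "?i (\<phi> p) = p" using inj_on_chart[OF A c] p by simp
  obtain r where r: "r > 0" "cball (\<phi> p) r \<subseteq> \<phi> ` U"
    using open_chart_range[OF A c] p by (meson imageI open_contains_cball)
  obtain \<rho> :: "'e \<Rightarrow> real" where \<rho>: "smooth_on UNIV \<rho>" "\<rho> (\<phi> p) \<noteq> 0" "\<And>x. x \<notin> cball (\<phi> p) r \<Longrightarrow> \<rho> x = 0"
    using exists_smooth_bump[OF r(1), of "\<phi> p"] by blast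
  let ?E = "cutoff_coordinate_field A U \<phi> \<rho>"
  have d: "linear (frechet_derivative (f \<circ> ?i) (at (\<phi> p)))" if "smooth_fun A f" for f
    using has_derivative_linear[OF smooth_on_has_derivative[OF smooth_funD[OF that c]]] p by blast
  have "?E (v + w) p = ?E v p + ?E w p" for v w
    using p by (auto simp: cutoff_coordinate_field_def fun_eq_iff linear_add[OF d] algebra_simps)
  moreover have "?E (a *\<^sub>R v) p = tscale a (?E v p)" for a v
    using p by (auto simp: cutoff_coordinate_field_def tscale_def fun_eq_iff linear_scale[OF d])
  moreover have "v = 0" if v: "?E v p = 0" for v
  proof -
    let ?F = "\<lambda>y. \<rho> y * ((y - \<phi> p) \<bullet> v)"
    let ?f = "\<lambda>q. if q \<in> U then ?F (\<phi> q) else 0"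
    have "bounded_linear (\<lambda>y. y \<bullet> v)" by (rule bounded_linear_inner_left)
    then have "smooth_on (\<phi> ` U) (\<lambda>y. y \<bullet> v + - (\<phi> p \<bullet> v))"
      by (intro smooth_on_add open_chart_range[OF A c])
        (auto simp: smooth_on_def intro: Ck_on_bounded_linear Ck_on_const)
    then have F: "smooth_on (\<phi> ` U) ?F"
      by (intro smooth_on_mult open_chart_range[OF A c] smooth_on_subset[OF \<rho>(1)])
        (auto simp: inner_diff_left)
    have sf: "smooth_fun A ?f"
      by (rule smooth_fun_extend_by_zero[OF A c F compact_cball r(2)]) (use \<rho>(3) in auto)
    have "(?F has_derivative (\<lambda>w. \<rho> (\<phi> p) * (w \<bullet> v) + frechet_derivative \<rho> (at (\<phi> p)) w * ((\<phi> p - \<phi> p) \<bullet> v)))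
        (at (\<phi> p))"
      by (rule has_derivative_mult[OF smooth_on_has_derivative[OF \<rho>(1) UNIV_I]])
        (auto intro!: derivative_eq_intros)
    then have "(?F has_derivative (\<lambda>w. \<rho> (\<phi> p) * (w \<bullet> v))) (at (\<phi> p))" by simp
    then have "(?f \<circ> ?i has_derivative (\<lambda>w. \<rho> (\<phi> p) * (w \<bullet> v))) (at (\<phi> p))"
      by (rule has_derivative_transform_within_open[OF _ open_chart_range[OF A c]])
        (use p inj_on_chart[OF A c] in auto)
    from frechet_derivative_at[OF this, symmetric]
    have "?E v p ?f = \<rho> (\<phi> p) * (\<rho> (\<phi> p) * (v \<bullet> v))"
      using sf p by (simp add: cutoff_coordinate_field_def)
    then show "v = 0" using v \<rho>(2) by simp
  qed
  moreover have "?E v \<in> vector_fields A" for v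
    by (rule cutoff_coordinate_field[OF A c \<rho>(1) compact_cball r(2) \<rho>(3)])
  ultimately show ?thesis by blast
qed

section \<open>Frames and the musical isomorphism of a neutral metric\<close>

locale neutral_manifold =
  fixes A :: "('a::{t2_space,second_countable_topology}, 'e::euclidean_space) atlas"
    and n :: nat and g :: "'a bilin"
  assumes atlas: "smooth_atlas A"
    and dim: "DIM('e) = 2 * n"
    and metric: "neutral_metric n A g"
begin

abbreviation T where "T \<equiv> tangent_space A"
abbreviation VF where "VF \<equiv> vector_fields A"
abbreviation C where "C \<equiv> smooth_fun A"

lemma sym: "u \<in> T p \<Longrightarrow> v \<in> T p \<Longrightarrow> g p u v = g p v u"
  using metric by (simp add: neutral_metric_def smooth_sym_bilin_def)

lemma add_left: "u \<in> T p \<Longrightarrow> v \<in> T p \<Longrightarrow> w \<in> T p \<Longrightarrow> g p (u + v) w = g p u w + g p v w"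
  using metric by (simp add: neutral_metric_def smooth_sym_bilin_def)

lemma scale_left: "u \<in> T p \<Longrightarrow> v \<in> T p \<Longrightarrow> g p (tscale c u) v = c * g p u v"
  using metric by (simp add: neutral_metric_def smooth_sym_bilin_def)

lemma add_right: "u \<in> T p \<Longrightarrow> v \<in> T p \<Longrightarrow> w \<in> T p \<Longrightarrow> g p w (u + v) = g p w u + g p w v"
  by (simp add: sym[of w p] tangent_add add_left)

lemma scale_right: "u \<in> T p \<Longrightarrow> v \<in> T p \<Longrightarrow> g p u (tscale c v) = c * g p u v"
  by (simp add: sym[of u p] tangent_scale scale_left)

lemma zero_left: "v \<in> T p \<Longrightarrow> g p 0 v = 0"
  using scale_left[of v p v 0] by (simp add: tscale_def zero_fun_def)

lemma minus_left: "u \<in> T p \<Longrightarrow> v \<in> T p \<Longrightarrow> g p (- u) v = - g p u v"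
  by (simp add: uminus_eq_tscale scale_left)

lemma diff_left: "u \<in> T p \<Longrightarrow> v \<in> T p \<Longrightarrow> w \<in> T p \<Longrightarrow> g p (u - v) w = g p u w - g p v w"
  using add_left[of u p "- v" w] by (simp add: tangent_uminus minus_left)

lemma diff_right: "u \<in> T p \<Longrightarrow> v \<in> T p \<Longrightarrow> w \<in> T p \<Longrightarrow> g p w (u - v) = g p w u - g p w v"
  by (simp add: sym[of w p] tangent_diff diff_left)

lemma sum_left:
  assumes "\<And>i. i \<in> I \<Longrightarrow> u i \<in> T p" "v \<in> T p"
  shows "g p (\<Sum>i\<in>I. u i) v = (\<Sum>i\<in>I. g p (u i) v)"
  using assms
  by (induction I rule: infinite_finite_induct) (simp_all add: zero_left add_left tangent_sum)

lemma smooth_metric: "X \<in> VF \<Longrightarrow> Y \<in> VF \<Longrightarrow> C (bilin_app g X Y)"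
  using metric by (simp add: neutral_metric_def smooth_sym_bilin_def)

text \<open>Pairing with the spanning family of the signature reads off coefficients up to sign, which turns
  the Gram matrix into nondegeneracy of \<open>g\<close>.\<close>

lemma orthonormal_basis:
  obtains e where "\<And>i. i < 2 * n \<Longrightarrow> e i \<in> T p"
    and "\<And>i j. i < 2 * n \<Longrightarrow> j < 2 * n \<Longrightarrow> i \<noteq> j \<Longrightarrow> g p (e i) (e j) = 0"
    and "\<And>i. i < 2 * n \<Longrightarrow> g p (e i) (e i) \<noteq> 0"
    and "\<And>w. w \<in> T p \<Longrightarrow> (\<And>i. i < 2 * n \<Longrightarrow> g p w (e i) = 0) \<Longrightarrow> w = 0"
proof -
  obtain e where e: "\<forall>i<2*n. e i \<in> T p" "\<forall>v\<in>T p. \<exists>c. v = (\<Sum>i<2*n. tscale (c i) (e i))"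
    "\<forall>i<2*n. \<forall>j<2*n. g p (e i) (e j) = (if i = j then if i < n then 1 else - 1 else 0)"
    using metric[unfolded neutral_metric_def neutral_signature_def, THEN conjunct2, THEN spec, of p]
    by (elim exE conjE)
  have "w = 0" if w: "w \<in> T p" "\<And>i. i < 2 * n \<Longrightarrow> g p w (e i) = 0" for w
  proof -
    obtain c where c: "w = (\<Sum>i<2*n. tscale (c i) (e i))" using e(2) w(1) by blast
    have "c j = 0" if j: "j < 2 * n" for j
    proof -
      have "0 = g p (\<Sum>i<2*n. tscale (c i) (e i)) (e j)" using w(2)[OF j] c by simp
      also have "\<dots> = (\<Sum>i<2*n. g p (tscale (c i) (e i)) (e j))"
        using e(1) j by (intro sum_left) (auto intro: tangent_scale)
      also have "\<dots> = (\<Sum>i<2*n. if i = j then c j * (if j < n then 1 else - 1) else 0)"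
        using e(1,3) j by (intro sum.cong) (auto simp: scale_left)
      also have "\<dots> = c j * (if j < n then 1 else - 1)" using j by simp
      finally show ?thesis by (simp split: if_splits)
    qed
    then show "w = 0" unfolding c by (intro sum.neutral) (simp add: tscale_def zero_fun_def)
  qed
  then show thesis using that[of e] e(1,3) by (metis zero_neq_one neg_equal_0_iff_equal)
qed

text \<open>A dimension count: pairing with the \<open>2n = DIM('e)\<close> vectors of an orthonormal basis turns \<open>L\<close> into an
  injective endomorphism of \<open>'e\<close>, which is onto. In particular every derivation is a combination of
  coordinate derivatives.\<close>

lemma injective_onto_tangent_space:
  fixes L :: "'e \<Rightarrow> 'a tangent"
  assumes mem: "\<And>v. L v \<in> T p"
    and add: "\<And>v w. L (v + w) = L v + L w"
    and scale: "\<And>c v. L (c *\<^sub>R v) = tscale c (L v)"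
    and inj: "\<And>v. L v = 0 \<Longrightarrow> v = 0"
    and u: "u \<in> T p"
  obtains v where "L v = u"
proof -
  obtain e where e: "\<And>i. i < 2 * n \<Longrightarrow> e i \<in> T p"
    "\<And>w. w \<in> T p \<Longrightarrow> (\<And>i. i < 2 * n \<Longrightarrow> g p w (e i) = 0) \<Longrightarrow> w = 0"
    using orthonormal_basis[of p] by metis
  obtain \<beta> where \<beta>: "bij_betw \<beta> (Basis :: 'e set) {..<2 * n}"
    using finite_same_card_bij[of "Basis :: 'e set" "{..<2 * n}"] dim by auto
  have \<beta>_less: "\<beta> b < 2 * n" if "b \<in> Basis" for b using \<beta> that by (auto simp: bij_betw_def)
  have \<beta>_surj: "\<exists>b\<in>Basis. \<beta> b = i" if "i < 2 * n" for i
    using \<beta> that by (metis bij_betw_imp_surj_on imageE lessThan_iff)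
  define M where "M w = (\<Sum>b\<in>Basis. g p w (e (\<beta> b)) *\<^sub>R b)" for w
  have M: "M w \<bullet> b = g p w (e (\<beta> b))" if "b \<in> Basis" for w b
    using that by (simp add: M_def inner_sum_left inner_Basis if_distrib cong: if_cong)
  have M_zero: "w = 0" if "w \<in> T p" "M w = 0" for w
  proof (rule e(2)[OF that(1)])
    fix i assume "i < 2 * n"
    then obtain b where "b \<in> Basis" "\<beta> b = i" using \<beta>_surj by blast
    then show "g p w (e i) = 0" using M[of b w] that(2) by simp
  qed
  have lin: "linear (\<lambda>v. M (L v))"
    by (rule linearI; rule euclidean_eqI)
      (simp_all add: M inner_add_left add scale add_left scale_left mem e(1) \<beta>_less)
  moreover have "inj (\<lambda>v. M (L v))"
    unfolding linear_injective_0[OF lin] using M_zero[OF mem] inj by blast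
  ultimately have "surj (\<lambda>v. M (L v))" by (rule linear_inj_imp_surj)
  then obtain v where v: "M (L v) = M u" by (metis surjD)
  have "L v - u = 0"
  proof (rule M_zero)
    show "M (L v - u) = 0"
      using v by (simp add: M_def diff_left mem u e(1) \<beta>_less scaleR_diff_left sum_subtractf)
  qed (intro tangent_diff mem u)
  then show thesis using that by simp
qed

text \<open>The coordinate fields at \<open>p\<close> span the tangent space by the dimension count.\<close>

lemma extend_tangent:
  assumes "u \<in> T p" obtains X where "X \<in> VF" "X p = u"
proof -
  obtain E :: "'e \<Rightarrow> 'a vfield" where E: "\<And>v. E v \<in> VF" "\<And>v w. E (v + w) p = E v p + E w p"
    "\<And>c v. E (c *\<^sub>R v) p = tscale c (E v p)" "\<And>v. E v p = 0 \<Longrightarrow> v = 0"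
    using exists_coordinate_fields[OF atlas, of p] by blast
  obtain v where "E v p = u"
    using injective_onto_tangent_space[of "\<lambda>v. E v p" p u, OF field_tangent[OF E(1)] E(2-4) assms] by blast
  then show thesis using that E(1) by blast
qed

text \<open>Orthogonal non-null vectors are independent, hence span by the dimension count; the coefficients
  are then the usual quotients.\<close>

lemma orthogonal_vectors_span:
  assumes f: "\<And>i. i < 2 * n \<Longrightarrow> f i \<in> T p"
    and orth: "\<And>i j. i < 2 * n \<Longrightarrow> j < 2 * n \<Longrightarrow> i \<noteq> j \<Longrightarrow> g p (f i) (f j) = 0"
    and nonnull: "\<And>i. i < 2 * n \<Longrightarrow> g p (f i) (f i) \<noteq> 0"
    and w: "w \<in> T p"
  shows "w = (\<Sum>i<2*n. tscale (g p w (f i) / g p (f i) (f i)) (f i))"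
proof -
  obtain \<beta> where \<beta>: "bij_betw \<beta> (Basis :: 'e set) {..<2 * n}"
    using finite_same_card_bij[of "Basis :: 'e set" "{..<2 * n}"] dim by auto
  define L where "L v = (\<Sum>i<2*n. tscale (v \<bullet> the_inv_into Basis \<beta> i) (f i))" for v
  have mem: "L v \<in> T p" for v
    unfolding L_def using f by (intro tangent_sum tangent_scale) auto
  have coeff: "g p (L v) (f j) = (v \<bullet> the_inv_into Basis \<beta> j) * g p (f j) (f j)" if j: "j < 2 * n" for v j
  proof -
    have "g p (L v) (f j) = (\<Sum>i<2*n. g p (tscale (v \<bullet> the_inv_into Basis \<beta> i) (f i)) (f j))"
      unfolding L_def using f j by (intro sum_left) (auto intro: tangent_scale)
    also have "\<dots> = (\<Sum>i<2*n. if i = j then (v \<bullet> the_inv_into Basis \<beta> j) * g p (f j) (f j) else 0)"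
      using f j orth by (intro sum.cong) (auto simp: scale_left)
    finally show ?thesis using j by simp
  qed
  obtain v where v: "L v = w"
  proof (rule injective_onto_tangent_space[OF mem _ _ _ w])
    show "L (v + w) = L v + L w" for v w
      by (simp add: L_def fun_eq_iff sum_fun_apply tscale_def inner_add_left algebra_simps sum.distrib)
    show "L (c *\<^sub>R v) = tscale c (L v)" for c v
      by (simp add: L_def fun_eq_iff sum_fun_apply tscale_def sum_distrib_left mult.assoc)
    show "v = 0" if "L v = 0" for v
    proof (rule euclidean_eqI)
      fix b :: 'e assume b: "b \<in> Basis"
      then have "\<beta> b < 2 * n" "the_inv_into Basis \<beta> (\<beta> b) = b"
        using \<beta> by (auto simp: bij_betw_def the_inv_into_f_f)
      then show "v \<bullet> b = 0 \<bullet> b"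
        using coeff[of "\<beta> b" v] nonnull[of "\<beta> b"] that zero_left[OF f, of "\<beta> b"] by simp
    qed
  qed
  have "w = (\<Sum>i<2*n. tscale (v \<bullet> the_inv_into Basis \<beta> i) (f i))" using v L_def by simp
  also have "\<dots> = (\<Sum>i<2*n. tscale (g p w (f i) / g p (f i) (f i)) (f i))"
    using coeff[of _ v] nonnull v by (intro sum.cong) auto
  finally show ?thesis .
qed

text \<open>Gram-Schmidt without division: with the pivot \<open>F m\<close>, a later field \<open>F j\<close> is replaced by
  \<open>g(F m, F m) F j - g(F j, F m) F m\<close>. The result is a global smooth field orthogonal to \<open>F m\<close>
  everywhere, and at \<open>p\<close>, where the fields are orthogonal from the start, it is a nonzero multiple of
  \<open>F j\<close>.\<close>

lemma orthogonal_fields: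
  obtains F where "\<And>i. i < 2 * n \<Longrightarrow> F i \<in> VF"
    and "\<And>i. i < 2 * n \<Longrightarrow> g p (F i p) (F i p) \<noteq> 0"
    and "\<And>i j q. i < 2 * n \<Longrightarrow> j < 2 * n \<Longrightarrow> i \<noteq> j \<Longrightarrow> g q (F i q) (F j q) = 0"
proof -
  \<comment> \<open>After \<open>m\<close> steps the first \<open>m\<close> fields are orthogonal to all others everywhere, the remaining ones
    to each other only at \<open>p\<close>.\<close>
  have "\<exists>F. (\<forall>i<2*n. F i \<in> VF) \<and> (\<forall>i<2*n. g p (F i p) (F i p) \<noteq> 0) \<and>
      (\<forall>i<2*n. \<forall>j<2*n. i \<noteq> j \<longrightarrow> g p (F i p) (F j p) = 0) \<and>
      (\<forall>i<m. \<forall>j<2*n. i \<noteq> j \<longrightarrow> (\<forall>q. g q (F i q) (F j q) = 0))"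
    if "m \<le> 2 * n" for m
    using that
  proof (induction m)
    case 0
    obtain e where e: "\<And>i. i < 2 * n \<Longrightarrow> e i \<in> T p"
      "\<And>i j. i < 2 * n \<Longrightarrow> j < 2 * n \<Longrightarrow> i \<noteq> j \<Longrightarrow> g p (e i) (e j) = 0"
      "\<And>i. i < 2 * n \<Longrightarrow> g p (e i) (e i) \<noteq> 0"
      using orthonormal_basis[of p] by metis
    have "\<forall>i. \<exists>X. i < 2 * n \<longrightarrow> X \<in> VF \<and> X p = e i"
      using extend_tangent[OF e(1)] by metis
    then obtain F where "\<forall>i. i < 2 * n \<longrightarrow> F i \<in> VF \<and> F i p = e i" by metis
    then show ?case using e by (intro exI[of _ F]) auto
  next
    case (Suc m)
    from Suc.IH[OF Suc_leD[OF Suc.prems]] obtain F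
      where F: "\<forall>i<2*n. F i \<in> VF" "\<forall>i<2*n. g p (F i p) (F i p) \<noteq> 0"
        "\<forall>i<2*n. \<forall>j<2*n. i \<noteq> j \<longrightarrow> g p (F i p) (F j p) = 0"
        "\<forall>i<m. \<forall>j<2*n. i \<noteq> j \<longrightarrow> (\<forall>q. g q (F i q) (F j q) = 0)"
      by (elim exE conjE)
    note F = F[rule_format]
    have m: "m < 2 * n" using Suc.prems by simp
    note tF = field_tangent[OF F(1)]
    define a where "a = bilin_app g (F m) (F m)"
    define F' where "F' j = (if j \<le> m then F j
      else fscale a (F j) - fscale (bilin_app g (F j) (F m)) (F m))" for j
    have F'_gt: "F' j q = tscale (a q) (F j q) - tscale (g q (F j q) (F m q)) (F m q)" if "\<not> j \<le> m" for j q
      using that by (simp add: F'_def fscale_def bilin_app_def)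
    have F'_le: "F' j = F j" if "j \<le> m" for j using that by (simp add: F'_def)
    have F'_p: "\<exists>s. s \<noteq> 0 \<and> F' j p = tscale s (F j p)" if j: "j < 2 * n" for j
    proof (cases "j \<le> m")
      case True
      then show ?thesis by (intro exI[of _ 1]) (simp add: F'_le tscale_def)
    next
      case False
      then have "F' j p = tscale (a p) (F j p)"
        using F'_gt[OF False, of p] F(3)[OF j m] by (simp add: tscale_def fun_eq_iff)
      then show ?thesis using F(2)[OF m] by (auto simp: a_def bilin_app_def)
    qed
    have 1: "F' i \<in> VF" if "i < 2 * n" for i
      unfolding F'_def a_def using that m F(1)
      by (auto intro!: field_diff field_fscale atlas smooth_metric)
    have 2: "g p (F' i p) (F' i p) \<noteq> 0" if "i < 2 * n" for i
      using F'_p[OF that] F(2)[OF that] tF[OF that, of p]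
      by (auto simp: scale_left scale_right tangent_scale)
    have 3: "g p (F' i p) (F' j p) = 0" if "i < 2 * n" "j < 2 * n" "i \<noteq> j" for i j
      using F'_p[OF that(1)] F'_p[OF that(2)] F(3)[OF that] tF[OF that(1), of p] tF[OF that(2), of p]
      by (auto simp: scale_left scale_right tangent_scale)
    have 4: "g q (F' i q) (F' j q) = 0" if i: "i < Suc m" and j: "j < 2 * n" and ij: "i \<noteq> j" for i j q
    proof -
      have i2: "i < 2 * n" using i m by simp
      note t = tF[OF i2, of q] tF[OF j, of q] tF[OF m, of q]
      show ?thesis
      proof (cases "j \<le> m")
        case True
        then show ?thesis
          using F(4)[of i j q] F(4)[of j i q] i j ij i2 sym[OF t(1,2)] by (auto simp: F'_le less_Suc_eq)
      next
        case False
        have "g q (F' i q) (F' j q) = a q * g q (F i q) (F j q) - g q (F j q) (F m q) * g q (F i q) (F m q)"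
          using i by (simp add: F'_le F'_gt[OF False] diff_right scale_right tangent_scale t)
        also have "\<dots> = 0"
          using i F(4)[of i j q] F(4)[of i m q] j m ij sym[OF t(2,3)]
          by (auto simp: less_Suc_eq a_def bilin_app_def)
        finally show ?thesis .
      qed
    qed
    show ?case by (intro exI[of _ F'] conjI allI impI) (simp_all only: 1 2 3 4 not_False_eq_True)
  qed
  from this[OF order_refl] obtain F where "\<forall>i<2*n. F i \<in> VF" "\<forall>i<2*n. g p (F i p) (F i p) \<noteq> 0"
      "\<forall>i<2*n. \<forall>j<2*n. i \<noteq> j \<longrightarrow> (\<forall>q. g q (F i q) (F j q) = 0)"
    by (elim exE conjE)
  then show thesis using that[of F] by simp
qed

text \<open>The expansion in the orthogonal fields, with denominators cleared so that it holds at every point of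
  the manifold: with \<open>H = \<Prod>\<^sub>i g(F i, F i)\<close>, take \<open>h = H\<^sup>2\<close>. A single factor \<open>H\<close> would not do, since the
  \<open>F i\<close> need not span where \<open>H = 0\<close>; the second one makes both sides vanish there.\<close>

lemma local_frame:
  obtains h k F where "C h" and "h p \<noteq> 0"
    and "\<And>i. i < 2 * n \<Longrightarrow> C (k i)" and "\<And>i. i < 2 * n \<Longrightarrow> F i \<in> VF"
    and "\<And>q w. w \<in> T q \<Longrightarrow> tscale (h q) w = (\<Sum>i<2*n. tscale (k i q * g q w (F i q)) (F i q))"
proof -
  obtain F where F: "\<And>i. i < 2 * n \<Longrightarrow> F i \<in> VF" "\<And>i. i < 2 * n \<Longrightarrow> g p (F i p) (F i p) \<noteq> 0"
    "\<And>i j q. i < 2 * n \<Longrightarrow> j < 2 * n \<Longrightarrow> i \<noteq> j \<Longrightarrow> g q (F i q) (F j q) = 0"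
    using orthogonal_fields[of p] by blast
  define d where "d i = bilin_app g (F i) (F i)" for i
  define H where "H = prod d {..<2 * n}"
  define k where "k i = H * prod d ({..<2 * n} - {i})" for i
  have prod_apply: "prod d I q = (\<Prod>i\<in>I. d i q)" for I q
    by (induction I rule: infinite_finite_induct) auto
  have d: "C (d i)" if "i < 2 * n" for i unfolding d_def using that by (intro smooth_metric F)
  have H: "C H" unfolding H_def using d by (intro smooth_fun_prod atlas) auto
  have "C (H * H)" by (intro smooth_fun_mult atlas H)
  moreover have "(H * H) p \<noteq> 0"
  proof -
    have "H p \<noteq> 0"
      unfolding H_def prod_apply using F(2) by (simp add: d_def bilin_app_def)
    then show ?thesis by simp
  qed
  moreover have "C (k i)" for i
    unfolding k_def using d by (intro smooth_fun_mult smooth_fun_prod atlas H) auto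
  moreover note F(1)
  moreover have "tscale ((H * H) q) w = (\<Sum>i<2*n. tscale (k i q * g q w (F i q)) (F i q))"
    if w: "w \<in> T q" for q w
  proof (cases "H q = 0")
    case True
    then show ?thesis by (simp add: k_def tscale_def fun_eq_iff sum_fun_apply)
  next
    case False
    then have nz: "d i q \<noteq> 0" if "i < 2 * n" for i
      using that unfolding H_def prod_apply by simp
    have k: "k i q * d i q = H q * H q" if "i < 2 * n" for i
    proof -
      have "H q = d i q * (\<Prod>j\<in>{..<2*n} - {i}. d j q)"
        unfolding H_def prod_apply using that by (intro prod.remove) auto
      then show ?thesis by (simp add: k_def prod_apply)
    qed
    have "w = (\<Sum>i<2*n. tscale (g q w (F i q) / g q (F i q) (F i q)) (F i q))"
      by (rule orthogonal_vectors_span[OF field_tangent[OF F(1)] F(3) _ w])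
        (use nz in \<open>auto simp: d_def bilin_app_def\<close>)
    then have "tscale ((H * H) q) w = (\<Sum>i<2*n. tscale (H q * H q * (g q w (F i q) / d i q)) (F i q))"
      by (simp add: d_def bilin_app_def tscale_def fun_eq_iff sum_fun_apply sum_distrib_left mult.assoc)
    also have "\<dots> = (\<Sum>i<2*n. tscale (k i q * g q w (F i q)) (F i q))"
    proof (rule sum.cong)
      fix i assume "i \<in> {..<2 * n}"
      then have "H q * H q * (g q w (F i q) / d i q) = k i q * g q w (F i q)"
        using k[of i, symmetric] nz[of i] by simp
      then show "tscale (H q * H q * (g q w (F i q) / d i q)) (F i q) = tscale (k i q * g q w (F i q)) (F i q)"
        by simp
    qed simp
    finally show ?thesis .
  qed
  ultimately show thesis using that[of "H * H" k F] by blast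
qed

lemma nondegenerate:
  assumes "w \<in> T p" "\<And>Z. Z \<in> VF \<Longrightarrow> g p w (Z p) = 0"
  shows "w = 0"
proof -
  obtain h k F where h: "C h" "h p \<noteq> 0" "\<And>i. i < 2 * n \<Longrightarrow> C (k i)" "\<And>i. i < 2 * n \<Longrightarrow> F i \<in> VF"
    "\<And>q w. w \<in> T q \<Longrightarrow> tscale (h q) w = (\<Sum>i<2*n. tscale (k i q * g q w (F i q)) (F i q))"
    using local_frame[of p] by blast
  have "tscale (h p) w = 0"
    unfolding h(5)[OF assms(1)] by (intro sum.neutral) (simp add: assms(2) h(4) tscale_def zero_fun_def)
  then show ?thesis using h(2) by (simp add: tscale_def fun_eq_iff)
qed

lemma field_eqI:
  assumes "V \<in> VF" "W \<in> VF" "\<And>Z. Z \<in> VF \<Longrightarrow> bilin_app g V Z = bilin_app g W Z"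
  shows "V = W"
proof
  fix p
  have "V p - W p = 0"
  proof (rule nondegenerate)
    fix Z assume "Z \<in> VF"
    then show "g p (V p - W p) (Z p) = 0"
      using assms(3)[of Z] by (simp add: diff_left field_tangent[OF assms(1)] field_tangent[OF assms(2)]
          field_tangent[of Z] bilin_app_def fun_eq_iff)
  qed (intro tangent_diff field_tangent assms)
  then show "V p = W p" by simp
qed

text \<open>Near each point, \<open>V f\<close> is a quotient of smooth functions by the frame expansion.\<close>

lemma field_of_smooth_products:
  assumes V: "\<And>p. V p \<in> T p" and smooth: "\<And>Z. Z \<in> VF \<Longrightarrow> C (bilin_app g V Z)"
  shows "V \<in> VF"
  unfolding vector_fields_def
proof (intro CollectI conjI allI impI V)
  fix f assume f: "C f"
  show "C (\<lambda>p. V p f)"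
  proof (rule smooth_fun_local_quotient[OF atlas])
    fix p
    obtain h k F where h: "C h" "h p \<noteq> 0" "\<And>i. i < 2 * n \<Longrightarrow> C (k i)" "\<And>i. i < 2 * n \<Longrightarrow> F i \<in> VF"
      "\<And>q w. w \<in> T q \<Longrightarrow> tscale (h q) w = (\<Sum>i<2*n. tscale (k i q * g q w (F i q)) (F i q))"
      using local_frame[of p] by blast
    let ?a = "\<Sum>i<2*n. (k i * bilin_app g V (F i)) * (\<lambda>q. F i q f)"
    have "C ?a"
      using h(3,4) smooth field_smooth[OF h(4) f] by (intro smooth_fun_sum smooth_fun_mult atlas) auto
    moreover have "h * (\<lambda>q. V q f) = ?a"
    proof
      fix q
      show "(h * (\<lambda>q. V q f)) q = ?a q"
        using fun_cong[OF h(5)[OF V[of q]], of f]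
        by (simp add: tscale_def sum_fun_apply bilin_app_def)
    qed
    ultimately show "\<exists>a b. C a \<and> C b \<and> b p \<noteq> 0 \<and> b * (\<lambda>q. V q f) = a"
      using h(1,2) by blast
  qed
qed

text \<open>A form that is linear over smooth functions is determined at \<open>p\<close> by its values on a frame, because
  \<open>local_frame\<close> expresses \<open>h Z\<close> globally through the \<open>F i\<close>. The coefficients of the representing
  vector at \<open>p\<close> are therefore read off from \<open>\<omega> (F i)\<close>.\<close>

lemma musical_isomorphism:
  assumes smooth: "\<And>Z. Z \<in> VF \<Longrightarrow> C (\<omega> Z)"
    and add: "\<And>Y Z. Y \<in> VF \<Longrightarrow> Z \<in> VF \<Longrightarrow> \<omega> (Y + Z) = \<omega> Y + \<omega> Z"
    and scale: "\<And>f Z. C f \<Longrightarrow> Z \<in> VF \<Longrightarrow> \<omega> (fscale f Z) = f * \<omega> Z"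
  obtains V where "V \<in> VF" "\<And>Z. Z \<in> VF \<Longrightarrow> bilin_app g V Z = \<omega> Z"
proof -
  have sum: "(\<Sum>i<m. X i) \<in> VF \<and> \<omega> (\<Sum>i<m. X i) = (\<Sum>i<m. \<omega> (X i))"
    if "\<And>i. i < m \<Longrightarrow> X i \<in> VF" for m and X :: "nat \<Rightarrow> 'a vfield"
    using that
  proof (induction m)
    case 0
    have z: "fscale (\<lambda>_. 0) 0 = (0 :: 'a vfield)" by (simp add: fscale_def tscale_def zero_fun_def)
    have "\<omega> 0 = 0"
      using scale[OF smooth_fun_const[of A 0] field_zero] unfolding z by (simp add: times_fun_def zero_fun_def)
    then show ?case using field_zero[of A] by (simp add: zero_fun_def)
  qed (simp add: field_add[OF atlas] add)
  have "\<exists>v. v \<in> T p \<and> (\<forall>Z\<in>VF. g p v (Z p) = \<omega> Z p)" for p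
  proof -
    obtain h k F where h: "C h" "h p \<noteq> 0" "\<And>i. i < 2 * n \<Longrightarrow> C (k i)" "\<And>i. i < 2 * n \<Longrightarrow> F i \<in> VF"
      "\<And>q w. w \<in> T q \<Longrightarrow> tscale (h q) w = (\<Sum>i<2*n. tscale (k i q * g q w (F i q)) (F i q))"
      using local_frame[of p] by blast
    note tF = field_tangent[OF h(4)]
    let ?v = "\<Sum>i<2*n. tscale (k i p * \<omega> (F i) p / h p) (F i p)"
    have "?v \<in> T p" using tF by (intro tangent_sum tangent_scale) auto
    moreover have "g p ?v (Z p) = \<omega> Z p" if Z: "Z \<in> VF" for Z
    proof -
      note tZ = field_tangent[OF Z]
      let ?X = "\<lambda>i. fscale (k i * bilin_app g Z (F i)) (F i)"
      have X: "?X i \<in> VF" if "i < 2 * n" for i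
        using that h(3,4) Z by (intro field_fscale smooth_fun_mult smooth_metric atlas) auto
      have "fscale h Z = (\<Sum>i<2*n. ?X i)"
      proof
        fix q show "fscale h Z q = (\<Sum>i<2*n. ?X i) q"
          using h(5)[OF tZ[of q]] by (simp add: fscale_def bilin_app_def sum_fun_apply)
      qed
      then have "h * \<omega> Z = (\<Sum>i<2*n. \<omega> (?X i))"
        using sum[of "2 * n" ?X] X scale[OF h(1) Z] by simp
      also have "\<dots> = (\<Sum>i<2*n. (k i * bilin_app g Z (F i)) * \<omega> (F i))"
        using h(3,4) Z by (intro sum.cong scale smooth_fun_mult smooth_metric atlas) auto
      finally have 1: "h p * \<omega> Z p = (\<Sum>i<2*n. k i p * g p (Z p) (F i p) * \<omega> (F i) p)"
        by (simp add: fun_eq_iff sum_fun_apply bilin_app_def)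
      have 2: "g p ?v (Z p) = (\<Sum>i<2*n. g p (tscale (k i p * \<omega> (F i) p / h p) (F i p)) (Z p))"
        using tF tZ by (intro sum_left) (auto intro: tangent_scale)
      have 3: "\<dots> = (\<Sum>i<2*n. k i p * g p (Z p) (F i p) * \<omega> (F i) p) / h p"
        unfolding sum_divide_distrib using tF tZ by (intro sum.cong) (auto simp: scale_left sym[of "Z p"])
      show ?thesis unfolding 2 3 1[symmetric] using h(2) by simp
    qed
    ultimately show ?thesis by blast
  qed
  then obtain V where V: "\<And>p. V p \<in> T p" "\<And>p Z. Z \<in> VF \<Longrightarrow> g p (V p) (Z p) = \<omega> Z p"
    by metis
  have eq: "bilin_app g V Z = \<omega> Z" if "Z \<in> VF" for Z
    using V(2)[OF that] by (simp add: bilin_app_def)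
  have "V \<in> VF"
    by (rule field_of_smooth_products[OF V(1)]) (simp add: eq smooth)
  then show thesis using that eq by blast
qed

end

section \<open>Connections on a neutral manifold\<close>

lemma vderiv_add:
  "X \<in> vector_fields A \<Longrightarrow> smooth_fun A f \<Longrightarrow> smooth_fun A h \<Longrightarrow>
    vderiv X (f + h) = vderiv X f + vderiv X h"
  by (simp add: vector_fields_def tangent_space_def vderiv_def fun_eq_iff)

lemma vderiv_mult:
  "X \<in> vector_fields A \<Longrightarrow> smooth_fun A f \<Longrightarrow> smooth_fun A h \<Longrightarrow>
    vderiv X (f * h) = vderiv X f * h + f * vderiv X h"
  by (simp add: vector_fields_def tangent_space_def vderiv_def fun_eq_iff)

lemma vderiv_add_field: "vderiv (X + Y) f = vderiv X f + vderiv Y f"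
  by (simp add: vderiv_def fun_eq_iff)

lemma vderiv_fscale: "vderiv (fscale h X) f = h * vderiv X f"
  by (simp add: vderiv_def fscale_def tscale_def fun_eq_iff)

lemma smooth_vderiv: "X \<in> vector_fields A \<Longrightarrow> smooth_fun A f \<Longrightarrow> smooth_fun A (vderiv X f)"
  by (simp add: vderiv_def vector_fields_def)

locale connection =
  fixes A :: "('a::{t2_space,second_countable_topology}, 'e::euclidean_space) atlas"
    and D :: "'a connection"
  assumes linear: "linear_connection A D"
begin

lemma field: "X \<in> vector_fields A \<Longrightarrow> Y \<in> vector_fields A \<Longrightarrow> D X Y \<in> vector_fields A"
  using linear unfolding linear_connection_def by blast

lemma add_direction:
  "X \<in> vector_fields A \<Longrightarrow> Y \<in> vector_fields A \<Longrightarrow> Z \<in> vector_fields A \<Longrightarrow> D (X + Y) Z = D X Z + D Y Z"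
  using linear unfolding linear_connection_def by blast

lemma add:
  "X \<in> vector_fields A \<Longrightarrow> Y \<in> vector_fields A \<Longrightarrow> Z \<in> vector_fields A \<Longrightarrow> D X (Y + Z) = D X Y + D X Z"
  using linear unfolding linear_connection_def by blast

lemma scale_direction:
  "X \<in> vector_fields A \<Longrightarrow> Y \<in> vector_fields A \<Longrightarrow> smooth_fun A f \<Longrightarrow> D (fscale f X) Y = fscale f (D X Y)"
  using linear unfolding linear_connection_def by blast

lemma leibniz:
  "X \<in> vector_fields A \<Longrightarrow> Y \<in> vector_fields A \<Longrightarrow> smooth_fun A f \<Longrightarrow>
    D X (fscale f Y) = fscale (vderiv X f) Y + fscale f (D X Y)"
  using linear unfolding linear_connection_def by blast

lemma uminus:
  assumes "smooth_atlas A" "X \<in> vector_fields A" "Y \<in> vector_fields A"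
  shows "D X (- Y) = - D X Y"
proof -
  have "D X 0 + D X 0 = D X 0"
    using add[OF assms(2) field_zero field_zero] by (simp only: add_0)
  then have "D X (Y + - Y) = 0" by simp
  then have "D X Y + D X (- Y) = 0"
    unfolding add[OF assms(2,3) field_uminus[OF assms(1,3)]] .
  then show ?thesis using minus_unique by metis
qed

end

locale neutral_manifold_connection = neutral_manifold A n g + connection A D
  for A :: "('a::{t2_space,second_countable_topology}, 'e::euclidean_space) atlas"
    and n and g :: "'a bilin" and D :: "'a connection"

context neutral_manifold
begin

abbreviation B where "B \<equiv> bilin_app g"

lemma B_sym: "X \<in> VF \<Longrightarrow> Y \<in> VF \<Longrightarrow> B X Y = B Y X"
  using sym[OF field_tangent field_tangent, of X Y] by (simp add: bilin_app_def fun_eq_iff)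

lemma B_add_left: "X \<in> VF \<Longrightarrow> Y \<in> VF \<Longrightarrow> Z \<in> VF \<Longrightarrow> B (X + Y) Z = B X Z + B Y Z"
  using add_left[OF field_tangent field_tangent field_tangent, of X Y Z]
  by (simp add: bilin_app_def fun_eq_iff)

lemma B_add_right: "X \<in> VF \<Longrightarrow> Y \<in> VF \<Longrightarrow> Z \<in> VF \<Longrightarrow> B Z (X + Y) = B Z X + B Z Y"
  using add_right[OF field_tangent field_tangent field_tangent, of X Y Z]
  by (simp add: bilin_app_def fun_eq_iff)

lemma B_diff_left: "X \<in> VF \<Longrightarrow> Y \<in> VF \<Longrightarrow> Z \<in> VF \<Longrightarrow> B (X - Y) Z = B X Z - B Y Z"
  using diff_left[OF field_tangent field_tangent field_tangent, of X Y Z]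
  by (simp add: bilin_app_def fun_eq_iff)

lemma B_diff_right: "X \<in> VF \<Longrightarrow> Y \<in> VF \<Longrightarrow> Z \<in> VF \<Longrightarrow> B Z (X - Y) = B Z X - B Z Y"
  using diff_right[OF field_tangent field_tangent field_tangent, of X Y Z]
  by (simp add: bilin_app_def fun_eq_iff)

lemma B_fscale_left: "X \<in> VF \<Longrightarrow> Y \<in> VF \<Longrightarrow> B (fscale f X) Y = f * B X Y"
  using scale_left[OF field_tangent field_tangent, of X Y]
  by (simp add: bilin_app_def fscale_def fun_eq_iff)

lemma B_zero_left: "Y \<in> VF \<Longrightarrow> B 0 Y = 0"
  using zero_left[OF field_tangent, of Y] by (simp add: bilin_app_def fun_eq_iff)

lemma B_minus_left: "X \<in> VF \<Longrightarrow> Y \<in> VF \<Longrightarrow> B (- X) Y = - B X Y"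
  using minus_left[OF field_tangent field_tangent, of X Y]
  by (simp add: bilin_app_def fun_eq_iff)

end

context neutral_manifold_connection
begin

abbreviation cov where "cov X Y Z \<equiv> cov_bilin D X g Y Z"

lemma smooth_cov: "X \<in> VF \<Longrightarrow> Y \<in> VF \<Longrightarrow> Z \<in> VF \<Longrightarrow> C (cov X Y Z)"
  unfolding cov_bilin_def by (intro smooth_fun_diff smooth_vderiv smooth_metric field atlas)

lemma cov_sym: "X \<in> VF \<Longrightarrow> Y \<in> VF \<Longrightarrow> Z \<in> VF \<Longrightarrow> cov X Y Z = cov X Z Y"
  by (simp add: cov_bilin_def B_sym[of Z] B_sym[of "D X Z"] field algebra_simps)

lemma cov_add_direction:
  "X \<in> VF \<Longrightarrow> X' \<in> VF \<Longrightarrow> Y \<in> VF \<Longrightarrow> Z \<in> VF \<Longrightarrow> cov (X + X') Y Z = cov X Y Z + cov X' Y Z"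
  by (simp add: cov_bilin_def add_direction vderiv_add_field B_add_left B_add_right field algebra_simps)

lemma cov_fscale_direction:
  assumes "X \<in> VF" "Y \<in> VF" "Z \<in> VF" "C f"
  shows "cov (fscale f X) Y Z = f * cov X Y Z"
proof -
  have "B Y (fscale f (D X Z)) = f * B Y (D X Z)"
    using assms by (simp add: B_sym[of Y] B_fscale_left field field_fscale atlas)
  then show ?thesis
    using assms by (simp add: cov_bilin_def scale_direction vderiv_fscale B_fscale_left field algebra_simps)
qed

lemma cov_add_left:
  assumes "X \<in> VF" "Y \<in> VF" "Y' \<in> VF" "Z \<in> VF"
  shows "cov X (Y + Y') Z = cov X Y Z + cov X Y' Z"
  using assms
  by (simp add: cov_bilin_def add B_add_left vderiv_add[OF assms(1)] smooth_metric field algebra_simps)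

lemma cov_fscale_left:
  assumes "X \<in> VF" "Y \<in> VF" "Z \<in> VF" "C f"
  shows "cov X (fscale f Y) Z = f * cov X Y Z"
proof -
  have "fscale (vderiv X f) Y \<in> VF" "fscale f (D X Y) \<in> VF"
    using assms by (auto intro!: field_fscale atlas field smooth_vderiv)
  then show ?thesis
    using assms by (simp add: cov_bilin_def leibniz B_add_left B_fscale_left vderiv_mult[OF assms(1)]
        smooth_metric field algebra_simps)
qed

lemma cov_add_right:
  "X \<in> VF \<Longrightarrow> Y \<in> VF \<Longrightarrow> Z \<in> VF \<Longrightarrow> Z' \<in> VF \<Longrightarrow> cov X Y (Z + Z') = cov X Y Z + cov X Y Z'"
  by (simp add: cov_sym[of X Y] cov_add_left field_add atlas)

lemma cov_fscale_right:
  "X \<in> VF \<Longrightarrow> Y \<in> VF \<Longrightarrow> Z \<in> VF \<Longrightarrow> C f \<Longrightarrow> cov X Y (fscale f Z) = f * cov X Y Z"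
  by (simp add: cov_sym[of X Y] cov_fscale_left field_fscale atlas)

text \<open>The value forced on \<open>g(\<nabla>\<^bsub>X\<^esub> Y - D\<^bsub>X\<^esub> Y, Z)\<close> when \<open>D\<close> is torsion-free and \<open>\<nabla>\<close> is the Levi-Civita
  connection: the Koszul formula, with \<open>D\<close> as the reference connection.\<close>

definition koszul where
  "koszul X Y Z = (\<lambda>_. 1 / 2) * (cov X Y Z + cov Y X Z - cov Z X Y)"

definition deformation where
  "deformation X Y = (SOME V. V \<in> VF \<and> (\<forall>Z\<in>VF. B V Z = koszul X Y Z))"

lemma deformation:
  assumes X: "X \<in> VF" and Y: "Y \<in> VF"
  shows "deformation X Y \<in> VF" and "\<And>Z. Z \<in> VF \<Longrightarrow> B (deformation X Y) Z = koszul X Y Z"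
proof -
  have "\<exists>V. V \<in> VF \<and> (\<forall>Z\<in>VF. B V Z = koszul X Y Z)"
  proof (rule musical_isomorphism[of "koszul X Y"])
    fix Z assume Z: "Z \<in> VF"
    show "C (koszul X Y Z)"
      unfolding koszul_def
      by (intro smooth_fun_mult smooth_fun_diff smooth_fun_add smooth_fun_const smooth_cov atlas X Y Z)
    show "koszul X Y (Z + Z') = koszul X Y Z + koszul X Y Z'" if "Z' \<in> VF" for Z'
      by (simp add: koszul_def cov_add_direction cov_add_right X Y Z that algebra_simps)
    show "koszul X Y (fscale f Z) = f * koszul X Y Z" if "C f" for f
      by (simp add: koszul_def cov_fscale_direction cov_fscale_right X Y Z that algebra_simps)
  qed blast
  from someI_ex[OF this] show "deformation X Y \<in> VF" "\<And>Z. Z \<in> VF \<Longrightarrow> B (deformation X Y) Z = koszul X Y Z"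
    by (simp_all add: deformation_def)
qed

lemma koszul_sym: "X \<in> VF \<Longrightarrow> Y \<in> VF \<Longrightarrow> Z \<in> VF \<Longrightarrow> koszul X Y Z = koszul Y X Z"
  by (simp add: koszul_def cov_sym[of Z X] algebra_simps)

lemma deformation_sym:
  assumes "X \<in> VF" "Y \<in> VF" shows "deformation X Y = deformation Y X"
  by (rule field_eqI) (simp_all add: deformation assms koszul_sym[of X])

lemma deformation_add:
  assumes "X \<in> VF" "X' \<in> VF" "Y \<in> VF"
  shows "deformation (X + X') Y = deformation X Y + deformation X' Y"
proof (rule field_eqI)
  fix Z assume "Z \<in> VF"
  then show "B (deformation (X + X') Y) Z = B (deformation X Y + deformation X' Y) Z"
    by (simp add: B_add_left deformation assms field_add atlas koszul_def
        cov_add_direction cov_add_left cov_add_right algebra_simps)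
qed (simp_all add: deformation assms field_add atlas)

lemma deformation_fscale:
  assumes "X \<in> VF" "Y \<in> VF" "C f"
  shows "deformation (fscale f X) Y = fscale f (deformation X Y)"
proof (rule field_eqI)
  fix Z assume "Z \<in> VF"
  then show "B (deformation (fscale f X) Y) Z = B (fscale f (deformation X Y)) Z"
    by (simp add: B_fscale_left deformation assms field_fscale atlas koszul_def
        cov_fscale_direction cov_fscale_left algebra_simps)
qed (simp_all add: deformation assms field_fscale atlas)

text \<open>The deformation is symmetric, so it keeps the torsion at zero, and in
  \<open>(D\<^bsub>X\<^esub> g)(Y, Z) - koszul X Y Z - koszul X Z Y\<close> all terms cancel.\<close>

theorem levi_civita_exists:
  assumes "torsion_free A D"
  shows "\<exists>N. levi_civita A g N"
proof
  let ?N = "\<lambda>X Y. D X Y + deformation X Y"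
  have "linear_connection A ?N"
    unfolding linear_connection_def
  proof (intro ballI conjI allI impI)
    fix X Y assume X: "X \<in> VF" and Y: "Y \<in> VF"
    show "?N X Y \<in> VF" by (intro field_add atlas field deformation X Y)
    fix Z assume Z: "Z \<in> VF"
    show "?N (X + Y) Z = ?N X Z + ?N Y Z"
      by (simp add: add_direction deformation_add X Y Z)
    have "deformation X (Y + Z) = deformation X Y + deformation X Z"
      using deformation_add[OF Y Z X] by (simp add: deformation_sym[of X] field_add atlas X Y Z)
    then show "?N X (Y + Z) = ?N X Y + ?N X Z"
      by (simp add: add X Y Z)
  next
    fix X Y f assume X: "X \<in> VF" and Y: "Y \<in> VF" and f: "C f"
    have fscale_add: "fscale f (U + V) = fscale f U + fscale f V" for U V :: "'a vfield"
      by (simp add: fscale_def tscale_def fun_eq_iff algebra_simps)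
    show "?N (fscale f X) Y = fscale f (?N X Y)"
      by (simp add: scale_direction deformation_fscale X Y f fscale_add)
    have "deformation X (fscale f Y) = fscale f (deformation X Y)"
      using deformation_fscale[OF Y X f] by (simp add: deformation_sym[of X] field_fscale atlas X Y f)
    then show "?N X (fscale f Y) = fscale (vderiv X f) Y + fscale f (?N X Y)"
      by (simp add: leibniz X Y f fscale_add)
  qed
  moreover have "torsion_free A ?N"
    unfolding torsion_free_def
  proof (intro ballI)
    fix X Y assume "X \<in> VF" "Y \<in> VF"
    then show "?N X Y - ?N Y X = lie_bracket X Y"
      using assms deformation_sym[of X Y] by (simp add: torsion_free_def)
  qed
  moreover have "cov_bilin ?N X g Y Z = 0" if X: "X \<in> VF" and Y: "Y \<in> VF" and Z: "Z \<in> VF" for X Y Z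
  proof -
    have "cov_bilin ?N X g Y Z = cov X Y Z - koszul X Y Z - koszul X Z Y"
      by (simp add: cov_bilin_def B_add_left B_add_right B_sym[of Y "deformation X Z"] deformation field X Y Z)
    also have "\<dots> = 0"
      by (simp add: koszul_def cov_sym[of X Z Y] cov_sym[of Y X Z] cov_sym[of Z X Y] X Y Z fun_eq_iff field_simps)
    finally show ?thesis .
  qed
  ultimately show "levi_civita A g ?N" by (simp add: levi_civita_def)
qed

end

section \<open>The Tachibana operator and Codazzi pairs\<close>

text \<open>The Tachibana operator \<open>\<Phi>\<^sub>J g\<close>: the two groups of terms are the Lie derivatives \<open>L\<^bsub>JX\<^esub> g\<close> and
  \<open>L\<^bsub>X\<^esub> (g \<circ> J)\<close>, evaluated on \<open>Y\<close> and \<open>Z\<close>.\<close>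

definition tachibana :: "'a endo \<Rightarrow> 'a bilin \<Rightarrow> 'a vfield \<Rightarrow> 'a vfield \<Rightarrow> 'a vfield \<Rightarrow> 'a \<Rightarrow> real" where
  "tachibana J g X Y Z =
    (vderiv (endo_app J X) (bilin_app g Y Z)
      - bilin_app g (lie_bracket (endo_app J X) Y) Z - bilin_app g Y (lie_bracket (endo_app J X) Z))
    - (vderiv X (bilin_app g (endo_app J Y) Z)
      - bilin_app g (endo_app J (lie_bracket X Y)) Z - bilin_app g (endo_app J Y) (lie_bracket X Z))"

locale anti_hermitian_manifold = neutral_manifold A n g
  for A :: "('a::{t2_space,second_countable_topology}, 'e::euclidean_space) atlas"
    and n and g :: "'a bilin" +
  fixes J :: "'a endo"
  assumes complex: "almost_complex A J"
    and anti_isometry: "\<And>X Y. X \<in> vector_fields A \<Longrightarrow> Y \<in> vector_fields A \<Longrightarrow>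
      bilin_app g (endo_app J X) (endo_app J Y) = - bilin_app g X Y"
begin

abbreviation J_app ("\<J>") where "\<J> \<equiv> endo_app J"

lemma J_field: "X \<in> VF \<Longrightarrow> \<J> X \<in> VF"
  using complex by (simp add: almost_complex_def smooth_endo_def)

lemma J_square: "X \<in> VF \<Longrightarrow> \<J> (\<J> X) = - X"
  using complex field_tangent[of X A] by (simp add: almost_complex_def endo_app_def fun_eq_iff)

lemma J_add: "X \<in> VF \<Longrightarrow> Y \<in> VF \<Longrightarrow> \<J> (X + Y) = \<J> X + \<J> Y"
  using complex field_tangent[of X A] field_tangent[of Y A]
  by (simp add: almost_complex_def smooth_endo_def endo_app_def fun_eq_iff)

lemma J_minus: "X \<in> VF \<Longrightarrow> \<J> (- X) = - \<J> X"
  using complex field_tangent[of X A]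
  by (simp add: almost_complex_def smooth_endo_def endo_app_def fun_eq_iff uminus_eq_tscale)

lemma J_diff: "X \<in> VF \<Longrightarrow> Y \<in> VF \<Longrightarrow> \<J> (X - Y) = \<J> X - \<J> Y"
  using J_add[of X "- Y"] by (simp add: J_minus field_uminus atlas)

lemma J_selfadjoint: "X \<in> VF \<Longrightarrow> Y \<in> VF \<Longrightarrow> B (\<J> X) Y = B X (\<J> Y)"
  using anti_isometry[of X "\<J> Y"]
  by (simp add: J_square J_field B_sym[of "\<J> X"] field_uminus atlas B_minus_left)

text \<open>Every bracket is a difference of covariant derivatives; regrouping them completes the derivatives of
  \<open>g\<close> and leaves the derivatives of \<open>J\<close>. The connection on the right is arbitrary, while the left side
  does not mention it.\<close>

lemma tachibana_torsion_free:
  assumes D: "linear_connection A D" "torsion_free A D"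
    and X: "X \<in> VF" and Y: "Y \<in> VF" and Z: "Z \<in> VF"
  shows "tachibana J g X Y Z = cov_bilin D (\<J> X) g Y Z - cov_bilin D X g (\<J> Y) Z
    - B (cov_endo D X J Y) Z + B (cov_endo D Y J X) Z + B Y (cov_endo D Z J X)"
proof -
  interpret connection A D by unfold_locales (rule D)
  have lie: "lie_bracket U V = D U V - D V U" if "U \<in> VF" "V \<in> VF" for U V
    using D(2) that by (simp add: torsion_free_def)
  note f = X Y Z J_field[OF X] J_field[OF Y] J_field[OF Z]
  have adj: "B Y (\<J> (D Z X)) = B (\<J> Y) (D Z X)"
    by (simp add: J_selfadjoint f field)
  show ?thesis
    by (simp add: tachibana_def cov_bilin_def cov_endo_def lie f field J_field J_diff B_diff_left B_diff_right adj
        algebra_simps)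
qed

text \<open>Differentiating \<open>J\<^sup>2 = -1\<close> shows that \<open>D\<^bsub>Z\<^esub> J\<close> anticommutes with \<open>J\<close>.\<close>

lemma cov_endo_J:
  assumes D: "linear_connection A D" and X: "X \<in> VF" and Z: "Z \<in> VF"
  shows "cov_endo D Z J (\<J> X) = - \<J> (cov_endo D Z J X)"
proof -
  interpret connection A D by unfold_locales (rule D)
  show ?thesis
    by (simp add: cov_endo_def J_square X Z uminus[OF atlas] field J_field J_diff)
qed

text \<open>The Codazzi condition cancels the two terms \<open>g((D\<^bsub>X\<^esub> J) Y, JZ)\<close> and \<open>g((D\<^bsub>Y\<^esub> J) X, JZ)\<close>. The third,
  \<open>g(Y, (D\<^bsub>JZ\<^esub> J) X)\<close>, equals \<open>g(Y, (D\<^bsub>JX\<^esub> J) Z)\<close>, which is what separates the derivative of \<open>G\<close> from that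
  of \<open>g\<close>.\<close>

lemma tachibana_codazzi:
  assumes D: "linear_connection A D" "torsion_free A D" and codazzi: "codazzi_pair A D J"
    and G: "\<And>p u v. u \<in> T p \<Longrightarrow> v \<in> T p \<Longrightarrow> G p u v = g p (J p u) v"
    and X: "X \<in> VF" and Y: "Y \<in> VF" and Z: "Z \<in> VF"
  shows "tachibana J g X Y (\<J> Z) = cov_bilin D (\<J> X) G Y Z - cov_bilin D X g (\<J> Y) (\<J> Z)"
proof -
  interpret connection A D by unfold_locales (rule D)
  note f = X Y Z J_field[OF X] J_field[OF Y] J_field[OF Z]
  have swap: "cov_endo D U J V = cov_endo D V J U" if "U \<in> VF" "V \<in> VF" for U V
    using codazzi that by (simp add: codazzi_pair_def)
  have G_eq: "bilin_app G U V = B U (\<J> V)" if "U \<in> VF" "V \<in> VF" for U V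
    unfolding J_selfadjoint[OF that, symmetric]
    using G[OF field_tangent[OF that(1)] field_tangent[OF that(2)]]
    by (simp add: bilin_app_def endo_app_def fun_eq_iff)
  have "cov_bilin D (\<J> X) G Y Z = cov_bilin D (\<J> X) g Y (\<J> Z) + B Y (cov_endo D (\<J> X) J Z)"
    by (simp add: cov_bilin_def cov_endo_def G_eq f field J_field B_diff_right algebra_simps)
  moreover have "cov_endo D (\<J> X) J Z = cov_endo D (\<J> Z) J X"
  proof -
    have "cov_endo D (\<J> X) J Z = - \<J> (cov_endo D Z J X)"
      using swap[OF f(4,3)] cov_endo_J[OF D(1) X Z] by simp
    also have "\<dots> = - \<J> (cov_endo D X J Z)" using swap[OF X Z] by simp
    also have "\<dots> = cov_endo D (\<J> Z) J X"
      using swap[OF f(6,1)] cov_endo_J[OF D(1) Z X] by simp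
    finally show ?thesis .
  qed
  ultimately show ?thesis
    using tachibana_torsion_free[OF D X Y f(6)] swap[OF X Y] by (simp add: algebra_simps)
qed

text \<open>For \<open>P(X, Y, Z) = g((\<nabla>\<^bsub>X\<^esub> J) Y, Z)\<close> one has \<open>\<Phi>(X, Y, Z) = - P(X, Y, Z) + P(Y, X, Z) + P(Z, X, Y)\<close>.
  Adding \<open>\<Phi>(X, Y, Z) = 0\<close> and \<open>\<Phi>(Y, X, Z) = 0\<close> leaves \<open>P(Z, X, Y) + P(Z, Y, X) = 0\<close>, hence
  \<open>P(Z, X, Y) = 0\<close> by symmetry in the last two arguments.\<close>

lemma parallel_iff_tachibana_zero:
  assumes N: "levi_civita A g N"
  shows "(\<forall>X\<in>VF. \<forall>Y\<in>VF. cov_endo N X J Y = 0) \<longleftrightarrow>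
    (\<forall>X\<in>VF. \<forall>Y\<in>VF. \<forall>Z\<in>VF. tachibana J g X Y Z = 0)"
proof -
  have lin: "linear_connection A N" and tf: "torsion_free A N"
    and met: "\<And>X Y Z. X \<in> VF \<Longrightarrow> Y \<in> VF \<Longrightarrow> Z \<in> VF \<Longrightarrow> cov_bilin N X g Y Z = 0"
    using N by (auto simp: levi_civita_def)
  interpret connection A N by unfold_locales (rule lin)
  define P where "P X Y Z = B (cov_endo N X J Y) Z" for X Y Z
  have cf: "cov_endo N X J Y \<in> VF" if "X \<in> VF" "Y \<in> VF" for X Y
    unfolding cov_endo_def using that by (intro field_diff atlas field J_field)
  have P_sym: "P X Y Z = P X Z Y" if X: "X \<in> VF" and Y: "Y \<in> VF" and Z: "Z \<in> VF" for X Y Z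
  proof -
    note f = X Y Z J_field[OF X] J_field[OF Y] J_field[OF Z]
    have "vderiv X (B (\<J> Y) Z) - B (N X (\<J> Y)) Z - B (\<J> Y) (N X Z) = 0"
      "vderiv X (B Y (\<J> Z)) - B (N X Y) (\<J> Z) - B Y (N X (\<J> Z)) = 0"
      using met[OF X f(5) Z] met[OF X Y f(6)] by (simp_all add: cov_bilin_def)
    moreover have "B (\<J> Y) Z = B Y (\<J> Z)" "B (\<J> (N X Y)) Z = B (N X Y) (\<J> Z)"
      "B (\<J> (N X Z)) Y = B (\<J> Y) (N X Z)" "B (N X (\<J> Z)) Y = B Y (N X (\<J> Z))"
      using B_sym[of "N X Z" "\<J> Y"] B_sym[of "N X (\<J> Z)" Y]
      by (simp_all add: J_selfadjoint f field)
    ultimately show ?thesis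
      by (simp add: P_def cov_endo_def B_diff_left f field J_field algebra_simps)
  qed
  have tach: "tachibana J g X Y Z = - P X Y Z + P Y X Z + P Z X Y"
    if X: "X \<in> VF" and Y: "Y \<in> VF" and Z: "Z \<in> VF" for X Y Z
    using tachibana_torsion_free[OF lin tf X Y Z] met[OF J_field[OF X] Y Z] met[OF X J_field[OF Y] Z]
      B_sym[OF Y cf[OF Z X]]
    by (simp add: P_def)
  show ?thesis
  proof (intro iffI ballI)
    fix X Y Z assume "\<forall>X\<in>VF. \<forall>Y\<in>VF. cov_endo N X J Y = 0" "X \<in> VF" "Y \<in> VF" "Z \<in> VF"
    then show "tachibana J g X Y Z = 0" by (simp add: tach P_def B_zero_left)
  next
    fix Z X assume 0: "\<forall>X\<in>VF. \<forall>Y\<in>VF. \<forall>Z\<in>VF. tachibana J g X Y Z = 0" and Z: "Z \<in> VF" and X: "X \<in> VF"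
    show "cov_endo N Z J X = 0"
    proof (rule field_eqI[OF cf[OF Z X] field_zero])
      fix Y assume Y: "Y \<in> VF"
      have cyc: "- P X' Y' Z' q + P Y' X' Z' q + P Z' X' Y' q = 0"
        if "X' \<in> VF" "Y' \<in> VF" "Z' \<in> VF" for X' Y' Z' q
        using fun_cong[OF tach[OF that], of q] 0 that by simp
      have "P Z X Y q = 0" for q
        using cyc[OF X Y Z, of q] cyc[OF Y X Z, of q] fun_cong[OF P_sym[OF Z X Y], of q] by linarith
      then have "P Z X Y = 0" by (simp add: fun_eq_iff)
      then show "B (cov_endo N Z J X) Y = B 0 Y" using Y by (simp add: P_def B_zero_left)
    qed
  qed
qed

end

theorem theorem3:
  fixes A :: "('a::{t2_space,second_countable_topology}, 'e::euclidean_space) atlas"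
    and J :: "'a endo" and g G :: "'a bilin" and D :: "'a connection" and n :: nat
  assumes "almost_anti_hermitian n A J g G"
    and "linear_connection A D"
    and "torsion_free A D"
    and "codazzi_pair A D J"
  shows "anti_kaehler n A J g G \<longleftrightarrow>
    (\<forall>X\<in>vector_fields A. \<forall>Y\<in>vector_fields A. \<forall>Z\<in>vector_fields A.
       cov_bilin D (endo_app J X) G Y Z = cov_bilin D X g (endo_app J Y) (endo_app J Z))"
proof -
  interpret anti_hermitian_manifold A n g J
    using assms(1) by unfold_locales (auto simp: almost_anti_hermitian_def)
  interpret neutral_manifold_connection A n g D
    by unfold_locales (rule assms(2))
  have G: "G p u v = g p (J p u) v" if "u \<in> T p" "v \<in> T p" for p u v
    using assms(1) that by (simp add: almost_anti_hermitian_def)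
  obtain N where N: "levi_civita A g N" using levi_civita_exists[OF assms(3)] by blast
  have "anti_kaehler n A J g G \<longleftrightarrow>
      (\<forall>X\<in>VF. \<forall>Y\<in>VF. \<forall>Z\<in>VF. tachibana J g X Y Z = 0)"
    unfolding anti_kaehler_def using assms(1) N parallel_iff_tachibana_zero by blast
  also have "\<dots> \<longleftrightarrow> (\<forall>X\<in>VF. \<forall>Y\<in>VF. \<forall>Z\<in>VF. tachibana J g X Y (\<J> Z) = 0)"
  proof (intro iffI ballI)
    fix X Y Z assume 0: "\<forall>X\<in>VF. \<forall>Y\<in>VF. \<forall>Z\<in>VF. tachibana J g X Y (\<J> Z) = 0"
      and f: "X \<in> VF" "Y \<in> VF" "Z \<in> VF"
    have "\<J> (- \<J> Z) = Z" using f by (simp add: J_minus J_field J_square)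
    then show "tachibana J g X Y Z = 0"
      using 0 f field_uminus[OF atlas J_field[OF f(3)]] by metis
  qed (simp add: J_field)
  also have "\<dots> \<longleftrightarrow> (\<forall>X\<in>VF. \<forall>Y\<in>VF. \<forall>Z\<in>VF.
      cov_bilin D (\<J> X) G Y Z = cov_bilin D X g (\<J> Y) (\<J> Z))"
    by (intro ball_cong refl) (simp only: tachibana_codazzi[OF assms(2-4) G] right_minus_eq)
  finally show ?thesis .
qed

end
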